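(* The automorphism group of the partially ordered set $(\mathcal{D};\sqsubseteq)$ is finite.
   Context: A directed graph (digraph) is a pair $G=(V,E)$ with $V$ a nonempty set and $E\subseteq V^2$ (loops allowed). $\mathcal{D}$ is the set of isomorphism types of finite digraphs. $G\sqsubseteq G'$ means $G$ is isomorphic to an induced substructure of $G'$ on some subset of its vertices; this is a partial order on $\mathcal{D}$. *)

theory Defs
  imports "HOL-Algebra.Bij" "HOL-Algebra.Order" "Graph_Theory.Graph_Theory"
begin

text \<open>
  Every nonempty finite digraph is isomorphic to one whose vertices are natural numbers, so the
  isomorphism types of finite digraphs are the isomorphism classes of the digraphs below. The
  locale \<^locale>\<open>pair_fin_digraph\<close> admits loops but also the empty vertex set, which
  is excluded here.
\<close>

definition nat_digraphs :: "nat pair_pre_digraph set"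
  where "nat_digraphs = {G. pair_fin_digraph G \<and> pverts G \<noteq> {}}"

definition digraph_iso_rel :: "nat pair_pre_digraph rel"
  where "digraph_iso_rel =
    {(G, H). G \<in> nat_digraphs \<and> H \<in> nat_digraphs \<and> digraph_iso (with_proj G) (with_proj H)}"

definition digraph_types :: "nat pair_pre_digraph set set"
  where "digraph_types = nat_digraphs // digraph_iso_rel"

definition embeds :: "'a pair_pre_digraph \<Rightarrow> 'b pair_pre_digraph \<Rightarrow> bool"
  where "embeds G H \<longleftrightarrow> (\<exists>S \<subseteq> pverts H. digraph_iso (with_proj G) (with_proj H \<restriction> S))"

text \<open>
  The order on types is independent of the chosen representatives; see
  \<open>digraph_poset_le_class_iff\<close> below.
\<close>

definition digraph_poset :: "nat pair_pre_digraph set gorder"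
  where "digraph_poset =
    \<lparr>carrier = digraph_types, eq = (=), le = (\<lambda>X Y. \<exists>G\<in>X. \<exists>H\<in>Y. embeds G H)\<rparr>"

text \<open>
  As in \<^const>\<open>AutoGroup\<close>, \<^const>\<open>Bij\<close> consists of functions extensional on
  the carrier, so each automorphism is counted once. Since \<^const>\<open>order_emb\<close> includes the
  requirement that its structures are weak partial orders, the set below would be empty for any
  other relation; \<open>partial_order_digraph_poset\<close> discharges this requirement for
  \<^const>\<open>digraph_poset\<close>.
\<close>

definition order_auto :: "('a, 'b) gorder_scheme \<Rightarrow> ('a \<Rightarrow> 'a) set"
  where "order_auto L = {f \<in> Bij (carrier L). order_emb L L f}"

definition order_AutoGroup :: "('a, 'b) gorder_scheme \<Rightarrow> ('a \<Rightarrow> 'a) monoid"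
  where "order_AutoGroup L = BijGroup (carrier L) \<lparr>carrier := order_auto L\<rparr>"

lemma digraph_iso_pair_iff:
  assumes "pair_wf_digraph G" "tail K = fst" "head K = snd"
  shows "digraph_iso (with_proj G) K \<longleftrightarrow>
    (\<exists>f. inj_on f (pverts G) \<and> verts K = f ` pverts G \<and> arcs K = map_prod f f ` parcs G)"
    (is "?L \<longleftrightarrow> ?R")
proof
  interpret G: pair_wf_digraph G by fact
  {
    assume ?L
    then obtain h where h: "pre_digraph.digraph_isomorphism (with_proj G) h"
      and K: "K = app_iso h (with_proj G)"
      unfolding digraph_iso_def by blast
    have th: "iso_tail h = fst" "iso_head h = snd"
      using K assms(2,3) by (auto simp: app_iso_def)
    have "iso_arcs h a = map_prod (iso_verts h) (iso_verts h) a" if "a \<in> parcs G" for a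
      using h that th unfolding pre_digraph.digraph_isomorphism_def
      by (cases a) (auto simp: prod_eq_iff)
    then have "arcs K = map_prod (iso_verts h) (iso_verts h) ` parcs G"
      using K by (auto simp: app_iso_def)
    moreover have "inj_on (iso_verts h) (pverts G)"
      using h unfolding pre_digraph.digraph_isomorphism_def by auto
    ultimately show ?R
      using K by (intro exI[of _ "iso_verts h"]) (auto simp: app_iso_def)
  next
    assume ?R
    then obtain f where f: "inj_on f (pverts G)" "verts K = f ` pverts G"
      "arcs K = map_prod f f ` parcs G"
      by blast
    let ?h = "\<lparr>iso_verts = f, iso_arcs = map_prod f f, iso_head = snd, iso_tail = fst\<rparr>"
    have "inj_on (map_prod f f) (parcs G)"
      by (rule inj_on_subset[OF map_prod_inj_on[OF f(1) f(1)]])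
        (auto dest: G.in_arcsD1 G.in_arcsD2)
    then have "pre_digraph.digraph_isomorphism (with_proj G) ?h"
      using f(1) G.wf_digraph_axioms unfolding pre_digraph.digraph_isomorphism_def by auto
    moreover have "K = app_iso ?h (with_proj G)"
      using f(2,3) assms(2,3) by (intro pre_digraph.equality) (auto simp: app_iso_def)
    ultimately show ?L
      unfolding digraph_iso_def by blast
  }
qed

lemma digraph_iso_iff:
  assumes "pair_wf_digraph G" "pair_wf_digraph H"
  shows "digraph_iso (with_proj G) (with_proj H) \<longleftrightarrow>
    (\<exists>f. bij_betw f (pverts G) (pverts H) \<and>
      (\<forall>u\<in>pverts G. \<forall>v\<in>pverts G. (u, v) \<in> parcs G \<longleftrightarrow> (f u, f v) \<in> parcs H))"
proof -
  interpret G: pair_wf_digraph G by fact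
  interpret H: pair_wf_digraph H by fact
  have "parcs H = map_prod f f ` parcs G \<longleftrightarrow>
      (\<forall>u\<in>pverts G. \<forall>v\<in>pverts G. (u, v) \<in> parcs G \<longleftrightarrow> (f u, f v) \<in> parcs H)"
    if f: "inj_on f (pverts G)" "f ` pverts G = pverts H" for f
  proof
    assume *: "parcs H = map_prod f f ` parcs G"
    show "\<forall>u\<in>pverts G. \<forall>v\<in>pverts G. (u, v) \<in> parcs G \<longleftrightarrow> (f u, f v) \<in> parcs H"
    proof (intro ballI iffI)
      fix u v assume uv: "u \<in> pverts G" "v \<in> pverts G" "(f u, f v) \<in> parcs H"
      then obtain u' v' where uv': "(u', v') \<in> parcs G" "f u = f u'" "f v = f v'"
        using * by auto
      then have "u = u'" "v = v'"
        using uv(1,2) f(1) G.in_arcsD1[OF uv'(1)] G.in_arcsD2[OF uv'(1)] by (auto dest: inj_onD)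
      then show "(u, v) \<in> parcs G" using uv'(1) by simp
    qed (use * in force)
  next
    assume *: "\<forall>u\<in>pverts G. \<forall>v\<in>pverts G. (u, v) \<in> parcs G \<longleftrightarrow> (f u, f v) \<in> parcs H"
    show "parcs H = map_prod f f ` parcs G"
    proof (intro equalityI subsetI)
      fix e assume "e \<in> parcs H"
      obtain x y where e: "e = (x, y)" by (cases e)
      have "x \<in> f ` pverts G" "y \<in> f ` pverts G"
        using H.in_arcsD1 H.in_arcsD2 \<open>e \<in> parcs H\<close> by (simp_all add: e f(2))
      then obtain u v where "u \<in> pverts G" "v \<in> pverts G" "x = f u" "y = f v"
        by blast
      then show "e \<in> map_prod f f ` parcs G"
        using * \<open>e \<in> parcs H\<close> e by force
    next
      fix e assume "e \<in> map_prod f f ` parcs G"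
      then obtain u v where uv: "(u, v) \<in> parcs G" "e = (f u, f v)" by auto
      then show "e \<in> parcs H"
        using * G.in_arcsD1[OF uv(1)] G.in_arcsD2[OF uv(1)] by blast
    qed
  qed
  then show ?thesis
    unfolding digraph_iso_pair_iff[OF assms(1) with_proj_simps(4,5)] with_proj_simps bij_betw_def
    by (intro ex_cong1) (metis (no_types))
qed

lemma embeds_iff:
  assumes "pair_wf_digraph G" "pair_wf_digraph H"
  shows "embeds G H \<longleftrightarrow>
    (\<exists>f. inj_on f (pverts G) \<and> f ` pverts G \<subseteq> pverts H \<and>
      (\<forall>u\<in>pverts G. \<forall>v\<in>pverts G. (u, v) \<in> parcs G \<longleftrightarrow> (f u, f v) \<in> parcs H))"
proof -
  have "digraph_iso (with_proj G) (with_proj H \<restriction> S) \<longleftrightarrow>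
      (\<exists>f. bij_betw f (pverts G) S \<and>
        (\<forall>u\<in>pverts G. \<forall>v\<in>pverts G. (u, v) \<in> parcs G \<longleftrightarrow> (f u, f v) \<in> parcs H))"
    for S
  proof -
    let ?K = "\<lparr>pverts = S, parcs = {e \<in> parcs H. fst e \<in> S \<and> snd e \<in> S}\<rparr>"
    have K: "with_proj H \<restriction> S = with_proj ?K"
      by (simp add: induce_subgraph_def with_proj_def)
    have wfK: "pair_wf_digraph ?K" by unfold_locales auto
    show ?thesis
      unfolding K digraph_iso_iff[OF assms(1) wfK]
      by (intro ex_cong1 conj_cong refl ball_cong) (auto dest: bij_betw_apply)
  qed
  moreover have "(\<exists>S\<subseteq>W. \<exists>f. bij_betw f V S \<and> P f) \<longleftrightarrow>
      (\<exists>f. inj_on f V \<and> f ` V \<subseteq> W \<and> P f)" for V W and P :: "('a \<Rightarrow> 'b) \<Rightarrow> bool"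
    by (auto simp: bij_betw_def)
  ultimately show ?thesis
    by (simp only: embeds_def)
qed

lemma nat_digraphs_wf: "G \<in> nat_digraphs \<Longrightarrow> pair_wf_digraph G"
  by (simp add: nat_digraphs_def pair_fin_digraph_def)

lemma nat_digraphs_finite: "G \<in> nat_digraphs \<Longrightarrow> finite (pverts G)"
  by (simp add: nat_digraphs_def pair_fin_digraph.pair_finite_verts)

lemma equiv_digraph_iso_rel: "equiv nat_digraphs digraph_iso_rel"
proof (rule equivI)
  show "digraph_iso_rel \<subseteq> nat_digraphs \<times> nat_digraphs"
    by (auto simp: digraph_iso_rel_def)
  show "refl_on nat_digraphs digraph_iso_rel"
  proof (rule refl_onI)
    fix G assume G: "G \<in> nat_digraphs"
    then have "digraph_iso (with_proj G) (with_proj G)"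
      by (subst digraph_iso_iff) (auto dest: nat_digraphs_wf intro!: exI[of _ id])
    then show "(G, G) \<in> digraph_iso_rel" using G by (simp add: digraph_iso_rel_def)
  qed
  show "sym digraph_iso_rel"
  proof (rule symI)
    fix G H assume GH: "(G, H) \<in> digraph_iso_rel"
    then interpret G: pair_wf_digraph G
      by (simp add: digraph_iso_rel_def nat_digraphs_wf)
    show "(H, G) \<in> digraph_iso_rel"
      using GH digraph_iso_swap[OF G.wf_digraph_axioms, of "with_proj H"]
      by (simp add: digraph_iso_rel_def)
  qed
  show "trans digraph_iso_rel"
    by (rule transI) (auto simp: digraph_iso_rel_def intro: digraph_iso_trans)
qed

lemma iso_imp_embeds: "(G, H) \<in> digraph_iso_rel \<Longrightarrow> embeds G H"
  unfolding digraph_iso_rel_def bij_betw_def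
  by (clarsimp simp: digraph_iso_iff embeds_iff nat_digraphs_wf bij_betw_def) blast

lemma embeds_trans:
  assumes "pair_wf_digraph G" "pair_wf_digraph H" "pair_wf_digraph K" "embeds G H" "embeds H K"
  shows "embeds G K"
proof -
  obtain f where f: "inj_on f (pverts G)" "f ` pverts G \<subseteq> pverts H"
    "\<forall>u\<in>pverts G. \<forall>v\<in>pverts G. (u, v) \<in> parcs G \<longleftrightarrow> (f u, f v) \<in> parcs H"
    using assms embeds_iff by blast
  obtain g where g: "inj_on g (pverts H)" "g ` pverts H \<subseteq> pverts K"
    "\<forall>u\<in>pverts H. \<forall>v\<in>pverts H. (u, v) \<in> parcs H \<longleftrightarrow> (g u, g v) \<in> parcs K"
    using assms embeds_iff by blast
  have "inj_on (g \<circ> f) (pverts G)"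
    using f(1,2) g(1) by (meson comp_inj_on inj_on_subset)
  moreover have "(g \<circ> f) ` pverts G \<subseteq> pverts K"
    using f(2) g(2) by auto
  moreover have "\<forall>u\<in>pverts G. \<forall>v\<in>pverts G. (u, v) \<in> parcs G \<longleftrightarrow> ((g \<circ> f) u, (g \<circ> f) v) \<in> parcs K"
    using f(2,3) g(3) by (auto simp: image_subset_iff)
  ultimately show ?thesis
    unfolding embeds_iff[OF assms(1,3)] by blast
qed

lemma embeds_antisym:
  assumes G: "G \<in> nat_digraphs" and H: "H \<in> nat_digraphs" and GH: "embeds G H" and HG: "embeds H G"
  shows "(G, H) \<in> digraph_iso_rel"
proof -
  note wf = nat_digraphs_wf[OF G] nat_digraphs_wf[OF H]
  note fin = nat_digraphs_finite[OF G] nat_digraphs_finite[OF H]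
  obtain f where f: "inj_on f (pverts G)" "f ` pverts G \<subseteq> pverts H"
    "\<forall>u\<in>pverts G. \<forall>v\<in>pverts G. (u, v) \<in> parcs G \<longleftrightarrow> (f u, f v) \<in> parcs H"
    using GH wf embeds_iff by blast
  obtain g where g: "inj_on g (pverts H)" "g ` pverts H \<subseteq> pverts G"
    using HG wf embeds_iff by blast
  have "card (pverts H) \<le> card (f ` pverts G)"
    using card_inj_on_le[OF g fin(1)] card_image[OF f(1)] by simp
  then have "f ` pverts G = pverts H"
    using f(2) fin by (intro card_seteq)
  then have "digraph_iso (with_proj G) (with_proj H)"
    unfolding digraph_iso_iff[OF wf] using f by (auto simp: bij_betw_def)
  then show ?thesis
    using G H by (simp add: digraph_iso_rel_def)
qed

lemma digraph_poset_le_class_iff: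
  assumes G: "G \<in> nat_digraphs" and H: "H \<in> nat_digraphs"
  shows "le digraph_poset (digraph_iso_rel `` {G}) (digraph_iso_rel `` {H}) \<longleftrightarrow> embeds G H"
proof
  assume "le digraph_poset (digraph_iso_rel `` {G}) (digraph_iso_rel `` {H})"
  then obtain G' H' where *: "(G, G') \<in> digraph_iso_rel" "(H, H') \<in> digraph_iso_rel" "embeds G' H'"
    by (auto simp: digraph_poset_def)
  then have "(H', H) \<in> digraph_iso_rel"
    using equiv_digraph_iso_rel by (meson equivE symE)
  moreover have "G' \<in> nat_digraphs" "H' \<in> nat_digraphs"
    using * by (auto simp: digraph_iso_rel_def)
  ultimately show "embeds G H"
    using * G H by (meson embeds_trans iso_imp_embeds nat_digraphs_wf)
next
  assume "embeds G H"
  then show "le digraph_poset (digraph_iso_rel `` {G}) (digraph_iso_rel `` {H})"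
    using equiv_class_self[OF equiv_digraph_iso_rel] G H by (auto simp: digraph_poset_def)
qed

lemma partial_order_digraph_poset: "partial_order digraph_poset"
proof -
  have carr: "X \<in> carrier digraph_poset \<Longrightarrow> \<exists>G\<in>nat_digraphs. X = digraph_iso_rel `` {G}" for X
    by (auto simp: digraph_poset_def digraph_types_def elim!: quotientE)
  have eq: "eq digraph_poset = (=)"
    by (simp add: digraph_poset_def)
  show ?thesis
  proof (unfold_locales, simp_all add: eq)
    fix X assume "X \<in> carrier digraph_poset"
    then show "le digraph_poset X X"
      using carr digraph_poset_le_class_iff equiv_class_self[OF equiv_digraph_iso_rel] iso_imp_embeds
      by (metis Image_singleton_iff)
  next
    fix X Y
    assume "le digraph_poset X Y" "le digraph_poset Y X"
      "X \<in> carrier digraph_poset" "Y \<in> carrier digraph_poset"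
    then show "X = Y"
      using carr digraph_poset_le_class_iff embeds_antisym equiv_class_eq[OF equiv_digraph_iso_rel]
      by metis
  next
    fix X Y Z
    assume "le digraph_poset X Y" "le digraph_poset Y Z" "X \<in> carrier digraph_poset"
      "Y \<in> carrier digraph_poset" "Z \<in> carrier digraph_poset"
    then show "le digraph_poset X Z"
      using carr digraph_poset_le_class_iff embeds_trans nat_digraphs_wf by metis
  qed
qed

lemma order_auto_digraph_poset_iff:
  "f \<in> order_auto digraph_poset \<longleftrightarrow> f \<in> extensional digraph_types \<and>
    bij_betw f digraph_types digraph_types \<and>
    (\<forall>X\<in>digraph_types. \<forall>Y\<in>digraph_types.
      le digraph_poset (f X) (f Y) \<longleftrightarrow> le digraph_poset X Y)"
proof -
  have "weak_partial_order digraph_poset"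
    using partial_order_digraph_poset by (simp add: partial_order_def)
  moreover have "carrier digraph_poset = digraph_types"
    by (simp add: digraph_poset_def)
  ultimately show ?thesis
    by (simp add: order_auto_def order_emb_def Bij_def)
qed

lemma group_order_AutoGroup:
  assumes "weak_partial_order L"
  shows "group (order_AutoGroup L)"
proof -
  let ?B = "BijGroup (carrier L)"
  interpret B: group ?B by (rule group_BijGroup)
  have "subgroup (order_auto L) ?B"
  proof (rule B.subgroupI)
    show "order_auto L \<subseteq> carrier ?B"
      by (auto simp: order_auto_def BijGroup_def)
    have "(\<lambda>x\<in>carrier L. x) \<in> order_auto L"
      using assms by (simp add: order_auto_def order_emb_def id_Bij)
    then show "order_auto L \<noteq> {}" by blast
  next
    fix f assume f: "f \<in> order_auto L"
    then have fB: "f \<in> Bij (carrier L)" and bij: "bij_betw f (carrier L) (carrier L)"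
      by (auto simp: order_auto_def Bij_def)
    have "le L (inv_into (carrier L) f x) (inv_into (carrier L) f y) \<longleftrightarrow> le L x y"
      if "x \<in> carrier L" "y \<in> carrier L" for x y
    proof -
      have "le L (f (inv_into (carrier L) f x)) (f (inv_into (carrier L) f y)) \<longleftrightarrow>
          le L (inv_into (carrier L) f x) (inv_into (carrier L) f y)"
        using f that Bij_inv_into_mem[OF fB] by (simp add: order_auto_def order_emb_def)
      then show ?thesis
        using bij_betw_inv_into_right[OF bij] that by simp
    qed
    then show "inv\<^bsub>?B\<^esub> f \<in> order_auto L"
      using assms fB by (simp add: inv_BijGroup order_auto_def order_emb_def restrict_inv_into_Bij)
  next
    fix f g assume "f \<in> order_auto L" "g \<in> order_auto L"
    moreover from this have "compose (carrier L) f g \<in> Bij (carrier L)"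
      by (simp add: order_auto_def compose_Bij)
    moreover have "g x \<in> carrier L" if "x \<in> carrier L" for x
      using \<open>g \<in> order_auto L\<close> that by (auto simp: order_auto_def dest: Bij_imp_funcset)
    ultimately show "f \<otimes>\<^bsub>?B\<^esub> g \<in> order_auto L"
      by (simp add: order_auto_def order_emb_def BijGroup_def compose_eq)
  qed
  then show ?thesis
    unfolding order_AutoGroup_def by (rule subgroup.subgroup_is_group) (rule group_BijGroup)
qed

end

theory Submission
  imports Defs
begin

text \<open>
  An automorphism preserves the number of vertices, so it suffices to show that one which fixes all
  types with at most 11 vertices is the identity: restriction to these finitely many types is then
  injective. A hub consists of a loopless transitive tournament on \<open>0, \<dots>, m - 1\<close> and of further
  vertices, the \<open>k\<close>-th of which has arcs to all \<open>i < p k\<close> and from all other \<open>i < m\<close>. This is the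
  reverse of what insertion into the tournament would require, so for suitable \<open>p\<close> the hub contains
  the tournament only once, and a further vertex can be recognised by its value \<open>p k\<close>. Hence a hub
  is determined by its subgraphs with one or two further vertices, which in turn are determined by
  subgraphs of bounded size, and all hubs are fixed. A digraph \<open>G\<close> in which every vertex has a
  symmetric pair with another one sits in a hub only disjointly from the tournament; this is a
  property of the order, so the image of \<open>G\<close> is the digraph induced on the further vertices, which
  is \<open>G\<close>. Finally, an arbitrary \<open>G\<close> is recovered from its two extensions by an isolated vertex and by
  a vertex joined to all others in both directions.
\<close>

section \<open>Digraphs given by relations, and embeddings between them\<close>

definition mk :: "'a set \<Rightarrow> ('a \<Rightarrow> 'a \<Rightarrow> bool) \<Rightarrow> 'a pair_pre_digraph"
  where "mk V R = \<lparr>pverts = V, parcs = {(u, v). u \<in> V \<and> v \<in> V \<and> R u v}\<rparr>"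

definition emb :: "('a \<Rightarrow> 'b) \<Rightarrow> 'a pair_pre_digraph \<Rightarrow> 'b pair_pre_digraph \<Rightarrow> bool"
  where "emb f G H \<longleftrightarrow> inj_on f (pverts G) \<and> f ` pverts G \<subseteq> pverts H \<and>
    (\<forall>u\<in>pverts G. \<forall>v\<in>pverts G. (u, v) \<in> parcs G \<longleftrightarrow> (f u, f v) \<in> parcs H)"

abbreviation ind :: "'a pair_pre_digraph \<Rightarrow> 'a set \<Rightarrow> 'a pair_pre_digraph"
  where "ind G A \<equiv> mk A (\<lambda>u v. (u, v) \<in> parcs G)"

lemma pverts_mk [simp]: "pverts (mk V R) = V"
  and parcs_mk [simp]: "(u, v) \<in> parcs (mk V R) \<longleftrightarrow> u \<in> V \<and> v \<in> V \<and> R u v"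
  by (simp_all add: mk_def)

lemma mk_nat_digraphs [simp]: "mk V R \<in> nat_digraphs \<longleftrightarrow> finite V \<and> V \<noteq> {}"
proof -
  have "pair_fin_digraph (mk V R)" if "finite V"
  proof
    show "finite (parcs (mk V R))"
      by (rule finite_subset[of _ "V \<times> V"]) (use that in auto)
  qed (use that in auto)
  then show ?thesis
    by (auto simp: nat_digraphs_def dest: pair_fin_digraph.pair_finite_verts)
qed

lemma embD:
  assumes "emb f G H"
  shows "inj_on f (pverts G)" "u \<in> pverts G \<Longrightarrow> f u \<in> pverts H"
    "u \<in> pverts G \<Longrightarrow> v \<in> pverts G \<Longrightarrow> (f u, f v) \<in> parcs H \<longleftrightarrow> (u, v) \<in> parcs G"
  using assms by (auto simp: emb_def)

lemma emb_comp: "emb f G H \<Longrightarrow> emb g H K \<Longrightarrow> emb (\<lambda>x. g (f x)) G K"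
  unfolding emb_def by (auto simp: inj_on_def image_subset_iff)

lemma emb_ind: "A \<subseteq> pverts G \<Longrightarrow> emb (\<lambda>x. x) (ind G A) G"
  by (auto simp: emb_def)

lemma emb_into_ind:
  "emb f G H \<Longrightarrow> f ` pverts G \<subseteq> A \<Longrightarrow> emb f G (ind H A)"
  by (auto simp: emb_def)

lemma embeds_emb_iff:
  "G \<in> nat_digraphs \<Longrightarrow> H \<in> nat_digraphs \<Longrightarrow> embeds G H \<longleftrightarrow> (\<exists>f. emb f G H)"
  by (simp add: embeds_iff nat_digraphs_wf emb_def)

lemma embeds_refl: "G \<in> nat_digraphs \<Longrightarrow> embeds G G"
  by (auto simp: embeds_emb_iff emb_def intro!: exI[of _ "\<lambda>x. x"])

lemma embeds_nat_trans:
  "embeds G H \<Longrightarrow> embeds H K \<Longrightarrow>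
    G \<in> nat_digraphs \<Longrightarrow> H \<in> nat_digraphs \<Longrightarrow> K \<in> nat_digraphs \<Longrightarrow> embeds G K"
  using embeds_trans nat_digraphs_wf by blast

lemma emb_card_le:
  "emb f G H \<Longrightarrow> H \<in> nat_digraphs \<Longrightarrow> card (pverts G) \<le> card (pverts H)"
  by (metis card_inj_on_le emb_def nat_digraphs_finite)

lemma emb_surj:
  assumes "emb f G H" "H \<in> nat_digraphs" "card (pverts H) \<le> card (pverts G)"
  shows "f ` pverts G = pverts H"
  using assms by (intro card_seteq) (auto simp: emb_def nat_digraphs_finite card_image)

text \<open>An injection into a finite set that is no larger is onto, and its inverse embeds
  \<open>H\<close> into \<open>G\<close>. From here on, mutual embeddability plays the role of
  isomorphism.\<close>

lemma embeds_card_eq_imp_embeds: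
  assumes "embeds G H" and GH: "G \<in> nat_digraphs" "H \<in> nat_digraphs"
    and c: "card (pverts H) \<le> card (pverts G)"
  shows "embeds H G"
proof -
  obtain f where f: "emb f G H"
    using assms embeds_emb_iff by blast
  have s: "f ` pverts G = pverts H"
    by (rule emb_surj[OF f GH(2) c])
  have "emb (inv_into (pverts G) f) H G"
    using f s unfolding emb_def
    by (auto simp: inj_on_inv_into inv_into_into f_inv_into_f)
  then show ?thesis
    using GH embeds_emb_iff by blast
qed

lemma embeds_ind:
  "G \<in> nat_digraphs \<Longrightarrow> A \<subseteq> pverts G \<Longrightarrow> A \<noteq> {} \<Longrightarrow> embeds (ind G A) G"
  by (subst embeds_emb_iff) (auto intro: emb_ind nat_digraphs_finite finite_subset)

lemma embeds_card_le:
  "embeds G H \<Longrightarrow> G \<in> nat_digraphs \<Longrightarrow> H \<in> nat_digraphs \<Longrightarrow>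
    card (pverts G) \<le> card (pverts H)"
  using embeds_emb_iff emb_card_le by blast

lemma nat_digraphs_card_pos: "G \<in> nat_digraphs \<Longrightarrow> 0 < card (pverts G)"
  using nat_digraphs_finite by (auto simp: nat_digraphs_def card_gt_0_iff)

section \<open>Transitive tournaments and hubs\<close>

abbreviation ttour :: "nat \<Rightarrow> nat pair_pre_digraph"
  where "ttour m \<equiv> mk {..<m} (<)"

text \<open>For \<open>k < n\<close>, \<open>u < p k\<close> and \<open>p k \<le> v < m\<close> the
  vertices \<open>m + k\<close>, \<open>u\<close>, \<open>v\<close> form a directed triangle. These
  triangles are what keeps further vertices out of copies of the tournament.\<close>

definition hub :: "nat \<Rightarrow> nat \<Rightarrow> (nat \<Rightarrow> nat) \<Rightarrow> (nat \<Rightarrow> nat \<Rightarrow> bool) \<Rightarrow> nat pair_pre_digraph"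
  where "hub m n p R = mk {..<m + n} (\<lambda>u v.
    if u < m then (if v < m then u < v else p (v - m) \<le> u)
    else (if v < m then v < p (u - m) else R (u - m) (v - m)))"

text \<open>The relation of a further vertex with value \<open>q\<close> to the tournament, carried
  over to a copy \<open>c\<close> of it in any digraph \<open>K\<close>.\<close>

definition cut :: "nat pair_pre_digraph \<Rightarrow> (nat \<Rightarrow> nat) \<Rightarrow> nat \<Rightarrow> nat \<Rightarrow> nat \<Rightarrow> bool"
  where "cut K c m x q \<longleftrightarrow>
    (\<forall>i<m. ((x, c i) \<in> parcs K \<longleftrightarrow> i < q) \<and> ((c i, x) \<in> parcs K \<longleftrightarrow> q \<le> i))"

lemma pverts_hub [simp]: "pverts (hub m n p R) = {..<m + n}"
  by (simp add: hub_def)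

lemma hub_nat_digraphs [simp]: "hub m n p R \<in> nat_digraphs \<longleftrightarrow> 0 < m + n"
  by (auto simp: hub_def)

lemma parcs_hub [simp]:
  assumes "i < m"
  shows "j < m \<Longrightarrow> (i, j) \<in> parcs (hub m n p R) \<longleftrightarrow> i < j"
    "k < n \<Longrightarrow> (i, m + k) \<in> parcs (hub m n p R) \<longleftrightarrow> p k \<le> i"
    "k < n \<Longrightarrow> (m + k, i) \<in> parcs (hub m n p R) \<longleftrightarrow> i < p k"
  using assms by (auto simp: hub_def)

lemma parcs_hub2 [simp]:
  "k < n \<Longrightarrow> l < n \<Longrightarrow> (m + k, m + l) \<in> parcs (hub m n p R) \<longleftrightarrow> R k l"
  by (auto simp: hub_def)

lemma emb_ttour_hub: "emb (\<lambda>x. x) (ttour m) (hub m n p R)"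
  by (auto simp: emb_def)

lemma less_add_cases:
  fixes u :: nat
  assumes "u < m + n"
  obtains "u < m" | k where "k < n" "u = m + k"
  using assms by (metis le_Suc_ex nat_add_left_cancel_less not_le)

lemma hub_emb:
  assumes c: "emb c (ttour m) K"
    and e: "inj_on e {..<n}" "\<And>k. k < n \<Longrightarrow> e k \<in> pverts K"
    and cut: "\<And>k. k < n \<Longrightarrow> cut K c m (e k) (p k)"
    and R: "\<And>k l. k < n \<Longrightarrow> l < n \<Longrightarrow> (e k, e l) \<in> parcs K \<longleftrightarrow> R k l"
  shows "emb (\<lambda>u. if u < m then c u else e (u - m)) (hub m n p R) K"
    (is "emb ?f _ _")
proof -
  \<comment> \<open>A common vertex has no loop, but the cut demands exactly one of the two arcs
    between \<open>e k\<close> and \<open>c i\<close>, and both would be that loop.\<close>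
  have ne: "c i \<noteq> e k" if "i < m" "k < n" for i k
  proof
    assume eq: "c i = e k"
    have "(c i, c i) \<notin> parcs K"
      using embD(3)[OF c, of i i] that by simp
    then show False
      using cut[OF that(2)] that(1) unfolding cut_def eq[symmetric] by force
  qed
  have inj: "inj_on c {..<m}"
    using embD(1)[OF c] by simp
  have "inj_on ?f {..<m + n}"
  proof (rule inj_onI)
    fix u v assume "u \<in> {..<m + n}" "v \<in> {..<m + n}" and eq: "?f u = ?f v"
    then have "u < m + n" "v < m + n" by auto
    then show "u = v"
      using eq inj e(1) ne
      by (elim less_add_cases) (auto simp: inj_on_def dest: ne[THEN not_sym])
  qed
  moreover have "?f u \<in> pverts K" if "u < m + n" for u
    using that e(2) embD(2)[OF c] by (elim less_add_cases) auto
  moreover have "(u, v) \<in> parcs (hub m n p R) \<longleftrightarrow> (?f u, ?f v) \<in> parcs K"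
    if "u < m + n" "v < m + n" for u v
    using that cut R embD(3)[OF c] by (elim less_add_cases) (auto simp: cut_def)
  ultimately show ?thesis
    unfolding emb_def pverts_hub image_subset_iff by simp
qed

lemma strict_mono_fin_id:
  fixes c :: "nat \<Rightarrow> nat"
  assumes mono: "\<And>i j. i < j \<Longrightarrow> j < m \<Longrightarrow> c i < c j" and bd: "\<And>i. i < m \<Longrightarrow> c i < m"
    and "i < m"
  shows "c i = i"
proof (rule antisym)
  show "i \<le> c i" using \<open>i < m\<close>
  proof (induction i)
    case (Suc i)
    then show ?case using mono[of i "Suc i"] by simp
  qed simp
  \<comment> \<open>Downward induction from \<open>m - 1\<close>, written as an induction on the
    distance \<open>k\<close> from it.\<close>
  have "k < m \<Longrightarrow> c (m - 1 - k) \<le> m - 1 - k" for k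
  proof (induction k)
    case 0
    then show ?case using bd[of "m - 1"] by simp
  next
    case (Suc k)
    then have "c (m - 1 - Suc k) < c (m - 1 - k)" by (intro mono) auto
    then show ?case using Suc by simp
  qed
  from this[of "m - 1 - i"] show "c i \<le> i" using \<open>i < m\<close> by simp
qed

lemma emb_ttour_acyclic:
  assumes c: "emb c (ttour m) K" and "x \<in> c ` {..<m}" "y \<in> c ` {..<m}" "z \<in> c ` {..<m}"
    and "(x, y) \<in> parcs K" "(y, z) \<in> parcs K" "(z, x) \<in> parcs K"
  shows False
proof -
  have "i < j" if "(c i, c j) \<in> parcs K" "i < m" "j < m" for i j
    using embD(3)[OF c, of i j] that by auto
  moreover obtain i j k where "x = c i" "y = c j" "z = c k" "i < m" "j < m" "k < m"
    using assms(2-4) by auto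
  ultimately show False
    using assms(5-7) by (meson less_asym less_trans)
qed

text \<open>If a copy of the tournament used \<open>m + k\<close>, its other vertices below
  \<open>m\<close> would all lie on one side of \<open>p k\<close>, since vertices on both sides
  close a directed triangle. By the bounds on \<open>p\<close>, either side together with all
  \<open>n\<close> further vertices has fewer than \<open>m\<close> elements. So the copy stays
  below \<open>m\<close>, where it is strictly increasing.\<close>

lemma emb_ttour_hub_id:
  assumes c: "emb c (ttour m) (hub m n p R)"
    and p: "\<And>k. k < n \<Longrightarrow> n < p k \<and> p k + n < m" and "i < m"
  shows "c i = i"
proof -
  have inj: "inj_on c {..<m}" and sub: "c ` {..<m} \<subseteq> {..<m + n}"
    using c by (auto simp: emb_def)
  have mono: "c i < c j" if "i < j" "j < m" "c i < m" "c j < m" for i j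
    using embD(3)[OF c, of i j] that by simp
  have "m + k \<notin> c ` {..<m}" if k: "k < n" for k
  proof
    assume x: "m + k \<in> c ` {..<m}"
    have *: "False" if "u < p k" "p k \<le> v" "v < m" "u \<in> c ` {..<m}" "v \<in> c ` {..<m}" for u v
      using emb_ttour_acyclic[OF c that(4,5) x] that k by simp
    then have "c ` {..<m} \<subseteq> {..<p k} \<union> {m..<m + n} \<or> c ` {..<m} \<subseteq> {p k..<m} \<union> {m..<m + n}"
      using sub by (auto simp: subset_iff) (metis image_eqI lessThan_iff not_le)
    moreover have "card (c ` {..<m}) = m"
      using inj by (simp add: card_image)
    moreover have "card ({..<p k} \<union> {m..<m + n}) \<le> p k + n"
      "card ({p k..<m} \<union> {m..<m + n}) \<le> (m - p k) + n"
      by (rule order.trans[OF card_Un_le], simp)+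
    ultimately have "m \<le> p k + n \<or> m \<le> (m - p k) + n"
      using card_mono[of "{..<p k} \<union> {m..<m + n}" "c ` {..<m}"]
        card_mono[of "{p k..<m} \<union> {m..<m + n}" "c ` {..<m}"] by auto
    then show False using p[OF k] by arith
  qed
  then have lt: "c i < m" if "i < m" for i
    using sub that by (metis image_eqI image_subset_iff lessThan_iff less_add_cases)
  have "c i < c j" if "i < j" "j < m" for i j
    using mono[OF that] lt[of i] lt[of j] that by simp
  then show ?thesis
    using strict_mono_fin_id[of m c i] lt \<open>i < m\<close> by blast
qed

text \<open>The embedding is the rank: the number of in-neighbours grows strictly along
  arcs.\<close>

lemma finite_strict_linear_embeds:
  assumes G: "G \<in> nat_digraphs"
    and irr: "\<And>u. u \<in> pverts G \<Longrightarrow> (u, u) \<notin> parcs G"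
    and tot: "\<And>u v. u \<in> pverts G \<Longrightarrow> v \<in> pverts G \<Longrightarrow> u \<noteq> v \<Longrightarrow>
      (u, v) \<in> parcs G \<or> (v, u) \<in> parcs G"
    and tr: "\<And>u v w. u \<in> pverts G \<Longrightarrow> v \<in> pverts G \<Longrightarrow> w \<in> pverts G \<Longrightarrow>
      (u, v) \<in> parcs G \<Longrightarrow> (v, w) \<in> parcs G \<Longrightarrow> (u, w) \<in> parcs G"
  shows "embeds G (ttour (card (pverts G)))"
proof -
  let ?V = "pverts G"
  define r where "r v = card {w \<in> ?V. (w, v) \<in> parcs G}" for v
  have fin: "finite ?V" using G by (rule nat_digraphs_finite)
  have less: "r u < r v" if "u \<in> ?V" "v \<in> ?V" "(u, v) \<in> parcs G" for u v
  proof -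
    have "{w \<in> ?V. (w, u) \<in> parcs G} \<subseteq> {w \<in> ?V. (w, v) \<in> parcs G}"
      using tr that by blast
    then have "{w \<in> ?V. (w, u) \<in> parcs G} \<subset> {w \<in> ?V. (w, v) \<in> parcs G}"
      using irr that by blast
    then show ?thesis unfolding r_def using fin by (simp add: psubset_card_mono)
  qed
  have "r v < card ?V" if "v \<in> ?V" for v
  proof -
    have "{w \<in> ?V. (w, v) \<in> parcs G} \<subset> ?V"
      using irr that by blast
    then show ?thesis unfolding r_def using fin by (simp add: psubset_card_mono)
  qed
  moreover have "(u, v) \<in> parcs G \<longleftrightarrow> r u < r v" if "u \<in> ?V" "v \<in> ?V" for u v
    using less[of u v] less[of v u] tot[OF that] irr that by (cases "u = v") auto
  moreover have "inj_on r ?V"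
  proof (rule inj_onI, rule ccontr)
    fix u v assume "u \<in> ?V" "v \<in> ?V" "r u = r v" "u \<noteq> v"
    then show False using less[of u v] less[of v u] tot[of u v] by auto
  qed
  ultimately have "emb r G (ttour (card ?V))"
    by (auto simp: emb_def)
  moreover have "ttour (card ?V) \<in> nat_digraphs"
    using nat_digraphs_card_pos[OF G] by auto
  ultimately show ?thesis
    using G embeds_emb_iff by blast
qed

lemma nat_digraph_split:
  assumes K: "K \<in> nat_digraphs" and c: "emb c (ttour m) K" and "card (pverts K) = m + n"
  shows "card (pverts K - c ` {..<m}) = n" "finite (pverts K - c ` {..<m})"
    "c ` {..<m} \<subseteq> pverts K"
proof -
  have "inj_on c {..<m}" "c ` {..<m} \<subseteq> pverts K"
    using c by (auto simp: emb_def)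
  then show "card (pverts K - c ` {..<m}) = n" "c ` {..<m} \<subseteq> pverts K"
    "finite (pverts K - c ` {..<m})"
    using assms nat_digraphs_finite[OF K] by (simp_all add: card_Diff_subset card_image)
qed

section \<open>Order isomorphisms that fix all small types\<close>

text \<open>\<open>F\<close> acts on representatives, so it is onto only up to mutual embeddability.
  The bound 11 is the size of the largest test digraph, the hub with nine tournament and two further
  vertices in \<open>fixed_hub_2\<close>.\<close>

locale small_fixing_aut =
  fixes F :: "nat pair_pre_digraph \<Rightarrow> nat pair_pre_digraph"
  assumes F_nd [simp]: "G \<in> nat_digraphs \<Longrightarrow> F G \<in> nat_digraphs"
    and F_embeds: "G \<in> nat_digraphs \<Longrightarrow> H \<in> nat_digraphs \<Longrightarrow>
      embeds (F G) (F H) \<longleftrightarrow> embeds G H"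
    and F_surj: "H \<in> nat_digraphs \<Longrightarrow> \<exists>G\<in>nat_digraphs. embeds (F G) H \<and> embeds H (F G)"
    and F_card: "G \<in> nat_digraphs \<Longrightarrow> card (pverts (F G)) = card (pverts G)"
    and F_small: "G \<in> nat_digraphs \<Longrightarrow> card (pverts G) \<le> 11 \<Longrightarrow> embeds G (F G)"
begin

definition fixed :: "nat pair_pre_digraph \<Rightarrow> bool"
  where "fixed G \<longleftrightarrow> G \<in> nat_digraphs \<and> embeds G (F G) \<and> embeds (F G) G"

lemma fixed_nd: "fixed G \<Longrightarrow> G \<in> nat_digraphs"
  by (simp add: fixed_def)

lemma fixedI1: "G \<in> nat_digraphs \<Longrightarrow> embeds G (F G) \<Longrightarrow> fixed G"
  by (simp add: fixed_def F_card embeds_card_eq_imp_embeds)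

lemma fixedI2: "G \<in> nat_digraphs \<Longrightarrow> embeds (F G) G \<Longrightarrow> fixed G"
  by (simp add: fixed_def F_card embeds_card_eq_imp_embeds)

lemma fixed_small: "G \<in> nat_digraphs \<Longrightarrow> card (pverts G) \<le> 11 \<Longrightarrow> fixed G"
  by (simp add: fixedI1 F_small)

text \<open>\<open>S\<close> and \<open>F S\<close> are interchangeable, and \<open>F\<close>
  preserves and reflects embeddings. This is how fixed digraphs serve as tests for an unknown
  image.\<close>

lemma fixed_embeds_iff:
  assumes S: "fixed S" and G: "G \<in> nat_digraphs"
  shows "embeds S (F G) \<longleftrightarrow> embeds S G"
proof -
  have nd: "S \<in> nat_digraphs" "F S \<in> nat_digraphs" "F G \<in> nat_digraphs"
    using S G by (simp_all add: fixed_def)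
  have "embeds S (F G) \<longleftrightarrow> embeds (F S) (F G)"
    using S embeds_nat_trans[of S "F S" "F G"] embeds_nat_trans[of "F S" S "F G"] nd
    by (auto simp: fixed_def)
  then show ?thesis using F_embeds nd G by simp
qed

lemma fixed_cong:
  assumes "fixed G" "H \<in> nat_digraphs" "embeds G H" "card (pverts H) \<le> card (pverts G)"
  shows "fixed H"
proof -
  have "embeds H G"
    using assms embeds_card_eq_imp_embeds fixed_nd by blast
  moreover have "embeds G (F H)"
    using assms(1-3) fixed_embeds_iff by blast
  ultimately show ?thesis
    by (meson F_nd assms(1,2) embeds_nat_trans fixedI1 fixed_nd)
qed

text \<open>Turns a subgraph of an image into a subgraph \<open>Y\<close> of the original, even
  where nothing is yet known to be fixed.\<close>

lemma embeds_F_preimage: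
  assumes "X \<in> nat_digraphs" "H \<in> nat_digraphs" "embeds X (F H)"
  obtains Y where "Y \<in> nat_digraphs" "embeds Y H" "embeds (F Y) X" "embeds X (F Y)"
    "card (pverts Y) = card (pverts X)"
proof -
  obtain Y where Y: "Y \<in> nat_digraphs" "embeds (F Y) X" "embeds X (F Y)"
    using F_surj assms(1) by blast
  then have "embeds Y H"
    using assms by (metis F_embeds F_nd embeds_nat_trans)
  moreover have "card (pverts Y) = card (pverts X)"
    using Y assms(1) by (metis F_card F_nd embeds_card_le le_antisym)
  ultimately show ?thesis using Y that by blast
qed

text \<open>Small induced subgraphs are fixed, so the image shows no small pattern that the original
  lacks. Local properties pass from \<open>G\<close> to \<open>F G\<close> in this way;
  \<open>pattern_up\<close> transfers the presence of a pattern.\<close>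

lemma pattern_down:
  assumes G: "G \<in> nat_digraphs" and A: "A \<subseteq> pverts (F G)" "card A \<le> 11"
  obtains f where "emb f (ind (F G) A) G"
\<comment> \<open>The empty digraph is not in \<open>nat_digraphs\<close>, so this case is
  separate.\<close>
proof (cases "A = {}")
  case True
  then show ?thesis by (auto simp: emb_def intro: that)
next
  case False
  then have nd: "ind (F G) A \<in> nat_digraphs"
    using finite_subset[OF A(1)] nat_digraphs_finite F_nd[OF G] by simp
  then have "fixed (ind (F G) A)"
    using A(2) by (intro fixed_small) auto
  moreover have "embeds (ind (F G) A) (F G)"
    using A False G by (intro embeds_ind) auto
  ultimately show ?thesis
    using that G nd fixed_embeds_iff embeds_emb_iff by blast
qed

lemma pattern_up:
  assumes G: "G \<in> nat_digraphs" and A: "A \<subseteq> pverts G" "card A \<le> 11"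
  obtains f where "emb f (ind G A) (F G)"
proof (cases "A = {}")
  case True
  then show ?thesis by (auto simp: emb_def intro: that)
next
  case False
  then have nd: "ind G A \<in> nat_digraphs"
    using finite_subset[OF A(1)] nat_digraphs_finite[OF G] by simp
  then have "fixed (ind G A)"
    using A(2) by (intro fixed_small) auto
  moreover have "embeds (ind G A) G"
    using A False G by (intro embeds_ind) auto
  ultimately show ?thesis
    using that G nd fixed_embeds_iff embeds_emb_iff F_nd by blast
qed

text \<open>Being a strict linear order is a condition on at most three vertices at a time, hence
  visible in small patterns.\<close>

lemma fixed_ttour:
  assumes "0 < m"
  shows "fixed (ttour m)"
proof -
  let ?T = "ttour m"
  have nd: "?T \<in> nat_digraphs" using assms by auto
  have *: "\<exists>f :: nat \<Rightarrow> nat. inj_on f A \<and> (\<forall>u\<in>A. \<forall>v\<in>A. (u, v) \<in> parcs (F ?T) \<longleftrightarrow> f u < f v)"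
    if A: "A \<subseteq> pverts (F ?T)" "card A \<le> 3" for A
  proof -
    obtain f where f: "emb f (ind (F ?T) A) ?T"
      using pattern_down[OF nd A(1)] A(2) by force
    show ?thesis
      using f by (intro exI[of _ f]) (auto simp: emb_def)
  qed
  have "embeds (F ?T) (ttour (card (pverts (F ?T))))"
  proof (rule finite_strict_linear_embeds)
    fix u assume u: "u \<in> pverts (F ?T)"
    show "(u, u) \<notin> parcs (F ?T)" using *[of "{u}"] u by auto
    fix v assume v: "v \<in> pverts (F ?T)"
    show "u \<noteq> v \<Longrightarrow> (u, v) \<in> parcs (F ?T) \<or> (v, u) \<in> parcs (F ?T)"
      using *[of "{u, v}"] u v by (auto simp: card_insert_if)
    fix w assume w: "w \<in> pverts (F ?T)" "(u, v) \<in> parcs (F ?T)" "(v, w) \<in> parcs (F ?T)"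
    have "card {u, v, w} \<le> 3" by (simp add: card_insert_if)
    then show "(u, w) \<in> parcs (F ?T)"
      using *[of "{u, v, w}"] u v w by auto
  qed (use nd in simp)
  moreover have "card (pverts (F ?T)) = m"
    using F_card[OF nd] by simp
  ultimately show ?thesis
    using nd by (simp add: fixedI2)
qed

lemma F_hub_chain:
  assumes "0 < m"
  obtains c where "emb c (ttour m) (F (hub m n p R))"
proof -
  have "\<exists>f. emb f (ttour m) (hub m n p R)"
    by (rule exI, rule emb_ttour_hub)
  then have "embeds (ttour m) (hub m n p R)"
    using assms by (subst embeds_emb_iff) auto
  then have "embeds (ttour m) (F (hub m n p R))"
    using assms fixed_embeds_iff[OF fixed_ttour[OF assms]] by auto
  then show ?thesis
    using assms that by (subst (asm) embeds_emb_iff) auto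
qed

text \<open>The tournament sits in the hub in a unique way, so it is also contained in the preimage of a
  subgraph that contains it, and the embeddings below must respect it.\<close>

lemma hub_extract:
  assumes p: "\<And>k. k < n \<Longrightarrow> n < p k \<and> p k + n < m" and "0 < m"
    and c: "emb c (ttour m) (F (hub m n p R))"
    and J: "J \<subseteq> pverts (F (hub m n p R)) - c ` {..<m}"
    and fx: "\<And>J'. J' \<subseteq> {m..<m + n} \<Longrightarrow> card J' = card J \<Longrightarrow>
      fixed (ind (hub m n p R) ({..<m} \<union> J'))"
  obtains g where "emb g (ind (F (hub m n p R)) (c ` {..<m} \<union> J)) (hub m n p R)"
    "\<And>i. i < m \<Longrightarrow> g (c i) = i"
proof -
  let ?H = "hub m n p R"
  let ?K = "F ?H"
  let ?X = "ind ?K (c ` {..<m} \<union> J)"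
  have H: "?H \<in> nat_digraphs" using \<open>0 < m\<close> by simp
  have T: "ttour m \<in> nat_digraphs" using \<open>0 < m\<close> by auto
  have K: "?K \<in> nat_digraphs" using H by simp
  have sub: "c ` {..<m} \<union> J \<subseteq> pverts ?K" and inj: "inj_on c {..<m}"
    using c J by (auto simp: emb_def)
  have finJ: "finite J"
    using sub nat_digraphs_finite[OF K] finite_subset by blast
  have X: "?X \<in> nat_digraphs"
    using finJ \<open>0 < m\<close> by auto
  have cardX: "card (pverts ?X) = m + card J"
  proof -
    have "card (c ` {..<m} \<union> J) = card (c ` {..<m}) + card J"
      using finJ J by (intro card_Un_disjoint) auto
    then show ?thesis using inj by (simp add: card_image)
  qed
  have "embeds ?X ?K"
    using sub K \<open>0 < m\<close> by (intro embeds_ind) auto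
  then obtain Y where Y: "Y \<in> nat_digraphs" "embeds Y ?H" "embeds (F Y) ?X" "embeds ?X (F Y)"
    "card (pverts Y) = card (pverts ?X)"
    using embeds_F_preimage[OF X H] by blast
  have cX: "emb c (ttour m) ?X"
    using c by (intro emb_into_ind) auto
  then have "embeds (ttour m) (F Y)"
    using X Y T by (meson F_nd embeds_emb_iff embeds_nat_trans)
  then have "embeds (ttour m) Y"
    using Y fixed_embeds_iff[OF fixed_ttour[OF \<open>0 < m\<close>]] by blast
  then obtain d where d: "emb d (ttour m) Y"
    using T Y embeds_emb_iff by blast
  obtain h where h: "emb h Y ?H"
    using Y H embeds_emb_iff by blast
  \<comment> \<open>By uniqueness of the tournament in the hub, any copy of it in \<open>Y\<close>
    is sent to the hub's own tournament.\<close>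
  have hd: "h (d i) = i" if "i < m" for i
    using emb_ttour_hub_id[OF emb_comp[OF d h] p that] .
  define J' where "J' = h ` pverts Y - {..<m}"
  have hY: "h ` pverts Y = {..<m} \<union> J'"
    using hd embD(2)[OF d] by (force simp: J'_def image_iff)
  have cardhY: "card (h ` pverts Y) = m + card J"
    using h Y(5) cardX by (simp add: emb_def card_image)
  have J': "J' \<subseteq> {m..<m + n}"
    using h by (force simp: J'_def emb_def)
  have "card ({..<m} \<union> J') = m + card J'"
    using J' finite_subset[OF J'] by (subst card_Un_disjoint) auto
  then have "card J' = card J"
    using cardhY hY by simp
  then have "fixed (ind ?H ({..<m} \<union> J'))"
    using fx J' by blast
  moreover have "emb h Y (ind ?H ({..<m} \<union> J'))"
    using h hY by (intro emb_into_ind) auto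
  \<comment> \<open>\<open>Y\<close> embeds into this fixed subgraph of the same size, so the two
    are isomorphic. Then \<open>?X\<close> is isomorphic to \<open>F Y\<close>, hence to
    \<open>Y\<close>, which lies in the hub.\<close>
  ultimately have "fixed Y"
    using Y(1) cardhY hY cardX Y(5)
    by (metis embeds_card_eq_imp_embeds embeds_emb_iff fixed_cong fixed_nd order_refl pverts_mk)
  then have "embeds ?X ?H"
    using X Y H by (metis F_nd embeds_nat_trans fixed_def)
  then obtain g where g: "emb g ?X ?H"
    using X H embeds_emb_iff by blast
  have "g (c i) = i" if "i < m" for i
    using emb_ttour_hub_id[OF emb_comp[OF cX g] p that] .
  then show ?thesis using g that by blast
qed

end

section \<open>Hubs with one further vertex\<close>

text \<open>The parameters are the sizes of the two sides of the cut, because embeddings compare the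
  sides separately.\<close>

definition hub1 :: "nat \<Rightarrow> nat \<Rightarrow> bool \<Rightarrow> nat pair_pre_digraph"
  where "hub1 a b l = hub (a + b) 1 (\<lambda>_. a) (\<lambda>_ _. l)"

lemma hub1_nat_digraphs [simp]: "hub1 a b l \<in> nat_digraphs"
  by (simp add: hub1_def)

lemma pverts_hub1 [simp]: "pverts (hub1 a b l) = {..a + b}"
  by (auto simp: hub1_def)

lemma parcs_hub1:
  "(u, v) \<in> parcs (hub1 a b l) \<longleftrightarrow> u \<le> a + b \<and> v \<le> a + b \<and>
    (if u < a + b then if v < a + b then u < v else a \<le> u else if v < a + b then v < a else l)"
  by (auto simp: hub1_def hub_def)

lemma hub1_tournament:
  "u \<le> a + b \<Longrightarrow> v \<le> a + b \<Longrightarrow> u \<noteq> v \<Longrightarrow>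
    (u, v) \<in> parcs (hub1 a b l) \<longleftrightarrow> (v, u) \<notin> parcs (hub1 a b l)"
  by (auto simp: parcs_hub1)

lemma hub1_cycle_vertex:
  assumes "(x, y) \<in> parcs (hub1 a b l)" "(y, z) \<in> parcs (hub1 a b l)"
    "(z, x) \<in> parcs (hub1 a b l)"
  shows "x = a + b \<or> y = a + b \<or> z = a + b"
  using assms unfolding parcs_hub1 by (auto split: if_splits)

text \<open>The triangle forces \<open>y < a \<le> z\<close>, and the two outcomes are the two sides
  on which \<open>t\<close> can lie.\<close>

lemma hub1_cycle_neighbour:
  assumes "(a + b, y) \<in> parcs (hub1 a b l)" "(y, z) \<in> parcs (hub1 a b l)"
    "(z, a + b) \<in> parcs (hub1 a b l)" "distinct [a + b, y, z, t]" "t \<le> a + b"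
  obtains "(y, t) \<in> parcs (hub1 a b l)" "(t, a + b) \<in> parcs (hub1 a b l)"
  | "(t, z) \<in> parcs (hub1 a b l)" "(a + b, t) \<in> parcs (hub1 a b l)"
proof (cases "t < a")
  case True
  then show ?thesis
    using that(2) assms by (simp add: parcs_hub1 split: if_splits)
next
  case False
  then show ?thesis
    using that(1) assms by (simp add: parcs_hub1 split: if_splits)
qed

text \<open>A directed triangle passes through \<open>a + b\<close>, and by
  \<open>hub1_cycle_neighbour\<close> any fourth vertex both receives an arc from it and sends one
  to it. These forbidden four-vertex patterns determine the shape of the image of a hub.\<close>

lemma hub1_no_cycle_sink_or_source:
  assumes "(x, y) \<in> parcs (hub1 a b l)" "(y, z) \<in> parcs (hub1 a b l)"
    "(z, x) \<in> parcs (hub1 a b l)" and d: "distinct [x, y, z, t]"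
    and "(x, t) \<in> parcs (hub1 a b l) \<and> (y, t) \<in> parcs (hub1 a b l) \<and> (z, t) \<in> parcs (hub1 a b l) \<or>
      (t, x) \<in> parcs (hub1 a b l) \<and> (t, y) \<in> parcs (hub1 a b l) \<and> (t, z) \<in> parcs (hub1 a b l)"
  shows False
proof -
  have le: "u \<le> a + b" if "u \<in> {x, y, z, t}" for u
    using assms that by (auto simp: parcs_hub1)
  \<comment> \<open>Stated for a triangle starting at \<open>a + b\<close>; the three cases below
    are its rotations.\<close>
  have sub: False if "p = a + b" "(p, q) \<in> parcs (hub1 a b l)" "(q, r) \<in> parcs (hub1 a b l)"
      "(r, p) \<in> parcs (hub1 a b l)" "{p, q, r} = {x, y, z}" "distinct [p, q, r, t]" for p q r
  proof -
    have "p \<le> a + b" "q \<le> a + b" "r \<le> a + b" "t \<le> a + b"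
      using le \<open>{p, q, r} = {x, y, z}\<close> by blast+
    then have anti: "(p, t) \<in> parcs (hub1 a b l) \<longleftrightarrow> (t, p) \<notin> parcs (hub1 a b l)"
      "(q, t) \<in> parcs (hub1 a b l) \<longleftrightarrow> (t, q) \<notin> parcs (hub1 a b l)"
      "(r, t) \<in> parcs (hub1 a b l) \<longleftrightarrow> (t, r) \<notin> parcs (hub1 a b l)"
      using hub1_tournament that(6) by (metis distinct_length_2_or_more)+
    have "(\<forall>v\<in>{p, q, r}. (v, t) \<in> parcs (hub1 a b l)) \<or> (\<forall>v\<in>{p, q, r}. (t, v) \<in> parcs (hub1 a b l))"
      unfolding that(5) using assms(5) by blast
    then show False
      using that(2-4,6) \<open>t \<le> a + b\<close> anti unfolding that(1)
      by (elim hub1_cycle_neighbour[of a b q l r t]) auto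
  qed
  from hub1_cycle_vertex[OF assms(1-3)] show False
  proof (elim disjE)
    assume "x = a + b"
    then show False using sub[of x y z] assms(1-4) by simp
  next
    assume "y = a + b"
    then show False using sub[of y z x] assms(1-4) by (simp add: insert_commute eq_commute)
  next
    assume "z = a + b"
    then show False using sub[of z x y] assms(1-4) by (simp add: insert_commute eq_commute)
  qed
qed

lemma hub1_mono:
  assumes "a \<le> a'" "b \<le> b'" "0 < a + b"
  shows "embeds (hub1 a b l) (hub1 a' b' l)"
proof -
  \<comment> \<open>The lower side keeps its place and the upper side is shifted to start at the new
    cut \<open>a'\<close>.\<close>
  have "emb (\<lambda>i. if i < a then i else i + (a' - a)) (ttour (a + b)) (hub1 a' b' l)"
    using assms by (auto simp: emb_def inj_on_def parcs_hub1)
  then have "emb (\<lambda>u. if u < a + b then (if u < a then u else u + (a' - a)) else a' + b')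
      (hub1 a b l) (hub1 a' b' l)"
    unfolding hub1_def[of a b l]
    by (rule hub_emb[where e = "\<lambda>_. a' + b'"]) (use assms in \<open>auto simp: cut_def parcs_hub1 inj_on_def\<close>)
  then show ?thesis
    using assms by (subst embeds_emb_iff) auto
qed

text \<open>With two vertices on each side, an embedding that moved \<open>a + b\<close> off
  \<open>a' + b'\<close> would leave a triangle whose image avoids \<open>a' + b'\<close>
  altogether. So \<open>a + b\<close> goes to \<open>a' + b'\<close>, and out-neighbours and
  in-neighbours give the two inequalities.\<close>

lemma hub1_le:
  assumes "embeds (hub1 a b l) (hub1 a' b' l)" "2 \<le> a" "2 \<le> b"
  shows "a \<le> a' \<and> b \<le> b'"
proof -
  obtain f where f: "emb f (hub1 a b l) (hub1 a' b' l)"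
    using assms(1) embeds_emb_iff[of "hub1 a b l" "hub1 a' b' l"] by auto
  have inj: "inj_on f {..a + b}"
    using embD(1)[OF f] by simp
  have arcs: "(f u, f v) \<in> parcs (hub1 a' b' l) \<longleftrightarrow> (u, v) \<in> parcs (hub1 a b l)"
    if "u \<le> a + b" "v \<le> a + b" for u v
    using embD(3)[OF f, of u v] that by simp
  have top: "f (a + b) = a' + b'"
  proof (rule ccontr)
    assume ne: "f (a + b) \<noteq> a' + b'"
    have "f 0 \<noteq> f 1"
      using inj_onD[OF inj, of 0 1] assms by auto
    then obtain i where i: "i \<in> {0, 1}" "f i \<noteq> a' + b'"
      by (metis insertI1 insertI2)
    have "f a \<noteq> f (a + 1)"
      using inj_onD[OF inj, of a "a + 1"] assms by auto
    then obtain j where j: "j \<in> {a, a + 1}" "f j \<noteq> a' + b'"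
      by (metis insertI1 insertI2)
    have "(i, j) \<in> parcs (hub1 a b l)" "(j, a + b) \<in> parcs (hub1 a b l)"
      "(a + b, i) \<in> parcs (hub1 a b l)"
      using i(1) j(1) assms(2,3) by (auto simp: parcs_hub1)
    moreover have "i \<le> a + b" "j \<le> a + b"
      using i(1) j(1) assms(2,3) by auto
    ultimately show False
      using hub1_cycle_vertex[of "f i" "f j" a' b' l "f (a + b)"] ne i(2) j(2) by (simp add: arcs)
  qed
  have lt: "f i < a' + b'" if "i < a + b" for i
  proof -
    have "f i \<noteq> f (a + b)"
      using inj_onD[OF inj, of i "a + b"] that by auto
    moreover have "f i \<le> a' + b'"
      using embD(2)[OF f, of i] that by simp
    ultimately show ?thesis using top by simp
  qed
  have "f ` {..<a} \<subseteq> {..<a'}"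
  proof clarsimp
    fix i assume "i < a"
    then have "(f (a + b), f i) \<in> parcs (hub1 a' b' l)"
      using arcs by (simp add: parcs_hub1)
    then show "f i < a'"
      using lt[of i] \<open>i < a\<close> top by (simp add: parcs_hub1)
  qed
  then have 1: "a \<le> a'"
    using card_inj_on_le[of f "{..<a}" "{..<a'}"] inj_on_subset[OF inj, of "{..<a}"] by force
  have "f ` {a..<a + b} \<subseteq> {a'..<a' + b'}"
  proof clarsimp
    fix i assume "a \<le> i" "i < a + b"
    then have "(f i, f (a + b)) \<in> parcs (hub1 a' b' l)"
      using arcs by (simp add: parcs_hub1)
    then show "a' \<le> f i \<and> f i < a' + b'"
      using lt[of i] \<open>i < a + b\<close> top by (simp add: parcs_hub1)
  qed
  then have "b \<le> b'"
    using card_inj_on_le[of f "{a..<a + b}" "{a'..<a' + b'}"] inj_on_subset[OF inj, of "{a..<a + b}"]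
    by force
  with 1 show ?thesis by simp
qed

context small_fixing_aut
begin

text \<open>The image is a tournament \<open>c\<close> with one more vertex \<open>x\<close>, and
  \<open>w i\<close> records whether \<open>x\<close> has an arc to \<open>c i\<close>. Four-vertex
  patterns allow \<open>w\<close> at most one change, and a triangle of the hub, which must reappear
  in the image, shows that the change is from true to false.\<close>

lemma F_hub1_form:
  assumes ab: "0 < a" "0 < b"
  obtains a' b' where "a' + b' = a + b" "0 < a'" "0 < b'" "embeds (hub1 a' b' l) (F (hub1 a b l))"
proof -
  let ?m = "a + b"
  let ?W = "hub1 a b l"
  let ?K = "F ?W"
  have W: "?W \<in> nat_digraphs" and K: "?K \<in> nat_digraphs" by simp_all
  obtain c where c: "emb c (ttour ?m) ?K"
    unfolding hub1_def
    by (rule F_hub_chain[of ?m 1 "\<lambda>_. a" "\<lambda>_ _. l"]) (use ab in simp)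
  have cardK: "card (pverts ?K) = ?m + 1"
    using F_card[OF W] by simp
  note split = nat_digraph_split[OF K c cardK]
  obtain x where x: "pverts ?K - c ` {..<?m} = {x}"
    using split(1) by (auto simp: card_1_singleton_iff)
  have cK: "c i \<in> pverts ?K" if "i < ?m" for i
    using split(3) that by auto
  have xc: "x \<noteq> c i" if "i < ?m" for i
    using x that by auto
  have xK: "x \<in> pverts ?K" using x by blast
  have Kx: "u \<in> c ` {..<?m}" if "u \<in> pverts ?K" "u \<noteq> x" for u
    using x that by blast
  have cc: "(c i, c j) \<in> parcs ?K \<longleftrightarrow> i < j" if "i < ?m" "j < ?m" for i j
    using embD(3)[OF c, of i j] that by simp
  have cne: "c i \<noteq> c j" if "i < j" "j < ?m" for i j
    using cc[of i j] cc[of j j] that by auto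
  have pat: "\<exists>f. inj_on f A \<and> (\<forall>u\<in>A. f u \<le> ?m) \<and>
      (\<forall>u\<in>A. \<forall>v\<in>A. (u, v) \<in> parcs ?K \<longleftrightarrow> (f u, f v) \<in> parcs ?W)"
    if A: "A \<subseteq> pverts ?K" "card A \<le> 4" for A
  proof -
    obtain f where "emb f (ind ?K A) ?W"
      using pattern_down[OF W A(1)] A(2) by force
    then show ?thesis
      by (intro exI[of _ f]) (auto simp: emb_def image_subset_iff)
  qed
  define w where "w i \<longleftrightarrow> (x, c i) \<in> parcs ?K" for i
  have w': "(c i, x) \<in> parcs ?K \<longleftrightarrow> \<not> w i" if i: "i < ?m" for i
  proof -
    have "{x, c i} \<subseteq> pverts ?K" "card {x, c i} \<le> 4"
      using xK cK[OF i] by (auto simp: card_insert_if)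
    then obtain f where "inj_on f {x, c i}" "\<forall>u\<in>{x, c i}. f u \<le> ?m"
      "\<forall>u\<in>{x, c i}. \<forall>v\<in>{x, c i}. (u, v) \<in> parcs ?K \<longleftrightarrow> (f u, f v) \<in> parcs ?W"
      using pat by meson
    then show ?thesis
      using hub1_tournament[of "f x" a b "f (c i)" l] xc[OF i] by (auto simp: w_def inj_on_def)
  qed
  have pat4: "\<exists>f. inj_on f {x, c i, c j, c k} \<and>
      (\<forall>u\<in>{x, c i, c j, c k}. \<forall>v\<in>{x, c i, c j, c k}.
        (u, v) \<in> parcs ?K \<longleftrightarrow> (f u, f v) \<in> parcs ?W)"
    if "i < j" "j < k" "k < ?m" for i j k
  proof -
    have "{x, c i, c j, c k} \<subseteq> pverts ?K" "card {x, c i, c j, c k} \<le> 4"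
      using xK cK[of i] cK[of j] cK[of k] that by (auto simp: card_insert_if)
    from pat[OF this] show ?thesis by (rule ex_forward) (elim conjE, intro conjI)
  qed
  \<comment> \<open>Here \<open>x\<close>, \<open>c i\<close>, \<open>c j\<close> form a directed
    triangle with common sink \<open>c k\<close>.\<close>
  have pmp: False if "i < j" "j < k" "k < ?m" "w i" "\<not> w j" "w k" for i j k
  proof -
    obtain f where f: "inj_on f {x, c i, c j, c k}"
      "\<forall>u\<in>{x, c i, c j, c k}. \<forall>v\<in>{x, c i, c j, c k}.
        (u, v) \<in> parcs ?K \<longleftrightarrow> (f u, f v) \<in> parcs ?W"
      using pat4[OF \<open>i < j\<close> \<open>j < k\<close> \<open>k < ?m\<close>] by (elim exE conjE)
    have "distinct [f x, f (c i), f (c j), f (c k)]"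
      using f(1) xc cne that by (auto simp: inj_on_def)
    then show False
      by (rule hub1_no_cycle_sink_or_source[where a = a and b = b and l = l, rotated 3])
         (use f(2) w' cc that in \<open>auto simp: w_def\<close>)
  qed
  \<comment> \<open>Here \<open>x\<close>, \<open>c j\<close>, \<open>c k\<close> form a directed
    triangle with common source \<open>c i\<close>.\<close>
  have mpm: False if "i < j" "j < k" "k < ?m" "\<not> w i" "w j" "\<not> w k" for i j k
  proof -
    obtain f where f: "inj_on f {x, c i, c j, c k}"
      "\<forall>u\<in>{x, c i, c j, c k}. \<forall>v\<in>{x, c i, c j, c k}.
        (u, v) \<in> parcs ?K \<longleftrightarrow> (f u, f v) \<in> parcs ?W"
      using pat4[OF \<open>i < j\<close> \<open>j < k\<close> \<open>k < ?m\<close>] by (elim exE conjE)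
    have "distinct [f x, f (c j), f (c k), f (c i)]"
      using f(1) xc cne that by (auto simp: inj_on_def)
    then show False
      by (rule hub1_no_cycle_sink_or_source[where a = a and b = b and l = l, rotated 3])
         (use f(2) w' cc that in \<open>auto simp: w_def\<close>)
  qed
  \<comment> \<open>As both sides of the cut are nonempty, \<open>0\<close> and
    \<open>?m - 1\<close> lie on different sides and form a triangle with \<open>?m\<close>. Its
    image must pass through \<open>x\<close>.\<close>
  obtain f where f: "emb f (ind ?W {0, ?m - 1, ?m}) ?K"
    by (rule pattern_up[OF W, of "{0, ?m - 1, ?m}"]) (auto simp: card_insert_if)
  have cyc: "(f ?m, f 0) \<in> parcs ?K" "(f 0, f (?m - 1)) \<in> parcs ?K" "(f (?m - 1), f ?m) \<in> parcs ?K"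
    using embD(3)[OF f] ab by (auto simp: parcs_hub1)
  have fK: "f ?m \<in> pverts ?K" "f 0 \<in> pverts ?K" "f (?m - 1) \<in> pverts ?K"
    using embD(2)[OF f] by auto
  have fne: "f ?m \<noteq> f 0" "f 0 \<noteq> f (?m - 1)" "f (?m - 1) \<noteq> f ?m"
    using embD(1)[OF f] ab by (auto simp: inj_on_def)
  have step: "\<exists>i j. i < j \<and> j < ?m \<and> w i \<and> \<not> w j"
    if "(x, u) \<in> parcs ?K" "(u, v) \<in> parcs ?K" "(v, x) \<in> parcs ?K" "u \<in> pverts ?K" "v \<in> pverts ?K"
      "u \<noteq> x" "v \<noteq> x" for u v
  proof -
    have "u \<in> c ` {..<?m}" "v \<in> c ` {..<?m}"
      using Kx that by auto
    then obtain i j where "u = c i" "i < ?m" "v = c j" "j < ?m"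
      by blast
    then show ?thesis using cc w' that by (auto simp: w_def)
  qed
  have "f ?m = x \<or> f 0 = x \<or> f (?m - 1) = x"
    using emb_ttour_acyclic[OF c _ _ _ cyc] Kx fK by blast
  then obtain i j where ij: "i < j" "j < ?m" "w i" "\<not> w j"
    using step[of "f 0" "f (?m - 1)"] step[of "f (?m - 1)" "f ?m"] step[of "f ?m" "f 0"] cyc fK fne
    by metis
  \<comment> \<open>The place of the change: \<open>mpm\<close> with the pair \<open>i\<close>,
    \<open>j\<close> excludes \<open>q = 0\<close>, and \<open>pmp\<close> excludes a return to true
    after \<open>q\<close>.\<close>
  define q where "q = (LEAST j. \<not> w j)"
  have q: "\<not> w q" "q \<le> j"
    unfolding q_def by (rule LeastI, rule ij(4)) (rule Least_le, rule ij(4))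
  have q_less: "w i" if "i < q" for i
    using not_less_Least that unfolding q_def by blast
  have q0: "0 < q"
  proof (rule ccontr)
    assume "\<not> 0 < q"
    then have "\<not> w 0" using q by simp
    then show False
      using mpm[of 0 i j] ij by (metis neq0_conv)
  qed
  have wq: "w i \<longleftrightarrow> i < q" if "i < ?m" for i
    using pmp[of 0 q i] q q_less q0 that by (metis not_less_iff_gr_or_eq)
  \<comment> \<open>The tournament is loopless on both sides, so a loop can only sit at
    \<open>?m\<close> and at \<open>x\<close>.\<close>
  have loop: "(x, x) \<in> parcs ?K \<longleftrightarrow> l"
  proof
    assume "(x, x) \<in> parcs ?K"
    moreover obtain f where "\<forall>u\<in>{x}. f u \<le> ?m"
      "\<forall>u\<in>{x}. \<forall>v\<in>{x}. (u, v) \<in> parcs ?K \<longleftrightarrow> (f u, f v) \<in> parcs ?W"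
      using pat[of "{x}"] xK by auto
    ultimately show l
      by (auto simp: parcs_hub1 split: if_splits)
  next
    assume l
    obtain f where f: "emb f (ind ?W {?m}) ?K"
      using pattern_up[OF W, of "{?m}"] by auto
    then have "(f ?m, f ?m) \<in> parcs ?K" "f ?m \<in> pverts ?K"
      using embD(2,3)[OF f, of ?m] embD(3)[OF f, of ?m ?m] \<open>l\<close> by (auto simp: parcs_hub1)
    then show "(x, x) \<in> parcs ?K"
      using Kx[of "f ?m"] cc by (cases "f ?m = x") auto
  qed
  have qm: "q < ?m" using q(2) ij(2) by simp
  have "embeds (hub ?m 1 (\<lambda>_. q) (\<lambda>_ _. l)) ?K"
  proof -
    have "emb (\<lambda>u. if u < ?m then c u else x) (hub ?m 1 (\<lambda>_. q) (\<lambda>_ _. l)) ?K"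
      by (rule hub_emb[where e = "\<lambda>_. x"])
         (use c xK w' wq loop in \<open>auto simp: cut_def w_def inj_on_def\<close>)
    then show ?thesis
      using K by (subst embeds_emb_iff) auto
  qed
  then show ?thesis
    using that[of q "?m - q"] q0 qm by (simp add: hub1_def)
qed

text \<open>Fixed hubs cannot distinguish the image \<open>hub1 a' b' l\<close> from the original.
  The five-vertex hub \<open>hub1 2 2 l\<close> is such a test and gives the lower bounds.\<close>

lemma F_hub1_form2:
  assumes ab: "2 \<le> a" "2 \<le> b"
  obtains a' b' where "a' + b' = a + b" "2 \<le> a'" "2 \<le> b'" "embeds (hub1 a' b' l) (F (hub1 a b l))"
    "\<And>i j. fixed (hub1 i j l) \<Longrightarrow> embeds (hub1 i j l) (hub1 a b l) \<Longrightarrow>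
      embeds (hub1 i j l) (hub1 a' b' l)"
    "\<And>i j. fixed (hub1 i j l) \<Longrightarrow> embeds (hub1 i j l) (hub1 a' b' l) \<Longrightarrow>
      embeds (hub1 i j l) (hub1 a b l)"
proof -
  let ?W = "hub1 a b l"
  obtain a' b' where a'b': "a' + b' = a + b" "0 < a'" "0 < b'" "embeds (hub1 a' b' l) (F ?W)"
    by (rule F_hub1_form[of a b l]) (use ab in simp_all)
  have eq: "embeds (F ?W) (hub1 a' b' l)"
    using embeds_card_eq_imp_embeds[OF a'b'(4)] a'b'(1) F_card[of ?W] by simp
  have up: "embeds (hub1 i j l) (hub1 a' b' l)"
    if "fixed (hub1 i j l)" "embeds (hub1 i j l) ?W" for i j
    using that fixed_embeds_iff[OF that(1), of ?W] eq
      embeds_nat_trans[of "hub1 i j l" "F ?W" "hub1 a' b' l"] by simp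
  have down: "embeds (hub1 i j l) ?W"
    if "fixed (hub1 i j l)" "embeds (hub1 i j l) (hub1 a' b' l)" for i j
    using that fixed_embeds_iff[OF that(1), of ?W] a'b'(4)
      embeds_nat_trans[of "hub1 i j l" "hub1 a' b' l" "F ?W"] by auto
  have "embeds (hub1 2 2 l) (hub1 a' b' l)"
    using up[of 2 2] fixed_small[of "hub1 2 2 l"] hub1_mono[of 2 a 2 b l] ab by simp
  then have "2 \<le> a'" "2 \<le> b'" using hub1_le[of 2 2] by auto
  then show ?thesis using that a'b' up down by blast
qed

text \<open>A side of size 2 cannot grow, since a six-vertex hub with sides 2 and 3 would detect it;
  the sum then determines the other side.\<close>

lemma fixed_hub1_small:
  assumes ab: "2 \<le> a" "2 \<le> b" "a = 2 \<or> b = 2"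
  shows "fixed (hub1 a b l)"
proof -
  obtain a' b' where a'b': "a' + b' = a + b" "2 \<le> a'" "2 \<le> b'"
    "embeds (hub1 a' b' l) (F (hub1 a b l))"
    and down: "\<And>i j. fixed (hub1 i j l) \<Longrightarrow> embeds (hub1 i j l) (hub1 a' b' l) \<Longrightarrow>
      embeds (hub1 i j l) (hub1 a b l)"
    by (rule F_hub1_form2[OF ab(1,2), of l]) blast
  have "\<not> 3 \<le> b'" if "b = 2"
    using down[of 2 3] fixed_small[of "hub1 2 3 l"] hub1_mono[of 2 a' 3 b' l] a'b'
      hub1_le[of 2 3 l a b] that by auto
  moreover have "\<not> 3 \<le> a'" if "a = 2"
    using down[of 3 2] fixed_small[of "hub1 3 2 l"] hub1_mono[of 3 a' 2 b' l] a'b'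
      hub1_le[of 3 2 l a b] that by auto
  ultimately have "a' = a \<and> b' = b"
    using ab(3) a'b'(1-3) by auto
  then show ?thesis
    using a'b'(4) ab by (intro fixedI1) auto
qed

text \<open>The fixed hubs \<open>hub1 a 2 l\<close> and \<open>hub1 2 b l\<close> bound the two
  sides of the image from below, and the equal sums leave no slack.\<close>

lemma fixed_hub1:
  assumes ab: "2 \<le> a" "2 \<le> b"
  shows "fixed (hub1 a b l)"
proof -
  obtain a' b' where a'b': "a' + b' = a + b" "2 \<le> a'" "2 \<le> b'"
    "embeds (hub1 a' b' l) (F (hub1 a b l))"
    and up: "\<And>i j. fixed (hub1 i j l) \<Longrightarrow> embeds (hub1 i j l) (hub1 a b l) \<Longrightarrow>
      embeds (hub1 i j l) (hub1 a' b' l)"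
    by (rule F_hub1_form2[OF ab(1,2), of l]) blast
  have "embeds (hub1 a 2 l) (hub1 a' b' l)" "embeds (hub1 2 b l) (hub1 a' b' l)"
    using ab by (intro up fixed_hub1_small hub1_mono; simp)+
  then have "a \<le> a'" "b \<le> b'"
    using hub1_le ab by blast+
  then have "a' = a \<and> b' = b"
    using a'b'(1) by simp
  then show ?thesis
    using a'b'(4) ab by (intro fixedI1) auto
qed

end

section \<open>Hubs with several further vertices\<close>

text \<open>The bounds make the copy of the tournament unique. The gaps leave three tournament
  vertices between consecutive values, which is the room for the test hub in
  \<open>fixed_hub_2\<close>.\<close>

definition spread :: "nat \<Rightarrow> nat \<Rightarrow> (nat \<Rightarrow> nat) \<Rightarrow> bool"
  where "spread m n p \<longleftrightarrow> (\<forall>k<n. n < p k \<and> p k + n < m) \<and> (\<forall>l<n. \<forall>k<l. p k + 3 \<le> p l)"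

lemma spreadD:
  assumes "spread m n p"
  shows "k < n \<Longrightarrow> n < p k \<and> p k + n < m" "l < n \<Longrightarrow> k < l \<Longrightarrow> p k + 3 \<le> p l"
    "k < n \<Longrightarrow> l < n \<Longrightarrow> p k = p l \<longleftrightarrow> k = l"
proof -
  show *: "l < n \<Longrightarrow> k < l \<Longrightarrow> p k + 3 \<le> p l" for k l
    using assms by (simp add: spread_def)
  show "k < n \<Longrightarrow> n < p k \<and> p k + n < m"
    using assms by (simp add: spread_def)
  show "k < n \<Longrightarrow> l < n \<Longrightarrow> p k = p l \<longleftrightarrow> k = l"
    using *[of k l] *[of l k] by (cases k l rule: linorder_cases) auto
qed

lemma cut_unique:
  assumes "cut K c m x q" "cut K c m x q'" "q < m" "q' < m"
  shows "q = q'"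
  using assms unfolding cut_def by (metis le_refl less_irrefl nat_neq_iff)

text \<open>The copy of the tournament already fills \<open>{..<m}\<close> under \<open>g\<close>,
  so by injectivity \<open>x\<close> goes to a further vertex, whose cut it inherits.\<close>

lemma extracted_vertex:
  assumes g: "emb g (ind K (c ` {..<m} \<union> J)) (hub m n p R)" "\<And>i. i < m \<Longrightarrow> g (c i) = i"
    and x: "x \<in> J" "J \<subseteq> pverts K - c ` {..<m}"
  obtains k where "k < n" "g x = m + k" "cut K c m x (p k)"
proof -
  have "g x \<noteq> i" if "i < m" for i
    using inj_onD[OF embD(1)[OF g(1)], of x "c i"] g(2)[OF that] that x by auto
  then have "\<not> g x < m" by blast
  moreover have "g x < m + n"
    using embD(2)[OF g(1), of x] x by simp
  ultimately obtain k where k: "k < n" "g x = m + k"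
    by (metis less_add_cases)
  have "cut K c m x (p k)"
    unfolding cut_def
  proof (intro allI impI)
    fix i assume i: "i < m"
    show "((x, c i) \<in> parcs K \<longleftrightarrow> i < p k) \<and> ((c i, x) \<in> parcs K \<longleftrightarrow> p k \<le> i)"
      using embD(3)[OF g(1), of x "c i"] embD(3)[OF g(1), of "c i" x] g(2)[OF i] k i x(1) by simp
  qed
  with k show ?thesis using that by blast
qed

context small_fixing_aut
begin

text \<open>Keeping only the further vertices selected by \<open>s\<close> yields a hub again, with
  \<open>p\<close> and \<open>R\<close> reindexed along \<open>s\<close>.\<close>

lemma fixed_sub_hub:
  assumes "inj_on s {..<j}" "s ` {..<j} \<subseteq> {..<n}" "0 < m"
    and fx: "fixed (hub m j (\<lambda>x. p (s x)) (\<lambda>x y. R (s x) (s y)))"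
  shows "fixed (ind (hub m n p R) ({..<m} \<union> (\<lambda>x. m + s x) ` {..<j}))"
proof -
  let ?A = "{..<m} \<union> (\<lambda>x. m + s x) ` {..<j}"
  have s: "s x < n" if "x < j" for x using assms(2) that by auto
  have "emb (\<lambda>u. u) (ttour m) (ind (hub m n p R) ?A)"
    by (rule emb_into_ind[OF emb_ttour_hub]) auto
  then have "emb (\<lambda>u. if u < m then u else m + s (u - m))
      (hub m j (\<lambda>x. p (s x)) (\<lambda>x y. R (s x) (s y))) (ind (hub m n p R) ?A)"
    by (rule hub_emb[where e = "\<lambda>x. m + s x"])
       (use assms(1) s in \<open>auto simp: inj_on_def cut_def\<close>)
  then have "embeds (hub m j (\<lambda>x. p (s x)) (\<lambda>x y. R (s x) (s y))) (ind (hub m n p R) ?A)"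
    using \<open>0 < m\<close> by (subst embeds_emb_iff) auto
  moreover have "card ?A \<le> m + j"
    using card_Un_le[of "{..<m}" "(\<lambda>x. m + s x) ` {..<j}"] card_image_le[of "{..<j}" "\<lambda>x. m + s x"]
    by simp
  ultimately show ?thesis
    using fx \<open>0 < m\<close> by (intro fixed_cong[OF fx]) auto
qed

lemma fixed_hub_1:
  assumes "2 \<le> q 0" "q 0 + 2 \<le> m"
  shows "fixed (hub m 1 q R)"
proof -
  have "hub m 1 q R = hub1 (q 0) (m - q 0) (R 0 0)"
    using assms by (auto simp: hub1_def hub_def mk_def)
  then show ?thesis
    using fixed_hub1[of "q 0" "m - q 0"] assms by simp
qed

text \<open>\<open>hub_extract\<close> for a single vertex, where the subgraphs required to be fixed
  are hubs with one further vertex.\<close>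

lemma hub_extract1:
  assumes sp: "spread m n p" "0 < m"
    and c: "emb c (ttour m) (F (hub m n p R))"
    and x: "x \<in> pverts (F (hub m n p R)) - c ` {..<m}"
  obtains k where "k < n" "cut (F (hub m n p R)) c m x (p k)"
    "(x, x) \<in> parcs (F (hub m n p R)) \<longleftrightarrow> R k k"
proof -
  let ?H = "hub m n p R"
  have "fixed (ind ?H ({..<m} \<union> J'))" if J': "J' \<subseteq> {m..<m + n}" "card J' = card {x}" for J'
  proof -
    obtain v where v: "J' = {v}" "v \<in> {m..<m + n}"
      using J' by (auto simp: card_1_singleton_iff)
    then obtain k where k: "k < n" "v = m + k"
      by (metis atLeastLessThan_iff le_Suc_ex nat_add_left_cancel_less)
    have "fixed (hub m 1 (\<lambda>_. p k) (\<lambda>_ _. R k k))"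
      using spreadD(1)[OF sp(1) k(1)] k(1) by (intro fixed_hub_1) auto
    from fixed_sub_hub[where s = "\<lambda>_. k" and p = p and R = R and j = 1, OF _ _ \<open>0 < m\<close> this, of n]
    show ?thesis using k v by (simp add: inj_on_def lessThan_Suc)
  qed
  then obtain g where g: "emb g (ind (F ?H) (c ` {..<m} \<union> {x})) ?H" "\<And>i. i < m \<Longrightarrow> g (c i) = i"
    using hub_extract[OF spreadD(1)[OF sp(1)] \<open>0 < m\<close> c, of "{x}"] x by blast
  obtain k where k: "k < n" "g x = m + k" "cut (F ?H) c m x (p k)"
    using extracted_vertex[OF g, of x] x by blast
  moreover have "(x, x) \<in> parcs (F ?H) \<longleftrightarrow> R k k"
    using embD(3)[OF g(1), of x x] k by simp
  ultimately show ?thesis using that by blast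
qed

text \<open>The hub with nine hub vertices and cuts at 3 and 6 is small, hence fixed, and still tells
  the order of two cuts.\<close>

lemma fixed_hub_2:
  assumes sp: "spread m 2 p"
  shows "fixed (hub m 2 p R)"
proof -
  let ?H = "hub m 2 p R"
  let ?K = "F ?H"
  let ?S = "hub 9 2 (\<lambda>k. if k = 0 then 3 else 6) R"
  have p: "2 < p 0" "p 0 + 3 \<le> p 1" "p 1 + 2 < m"
    using spreadD(1)[OF sp, of 0] spreadD(1)[OF sp, of 1] spreadD(2)[OF sp, of 1 0] by auto
  then have m: "0 < m" by simp
  have H: "?H \<in> nat_digraphs" and K: "?K \<in> nat_digraphs" by simp_all
  \<comment> \<open>Three tournament vertices from each of the three intervals into which
    \<open>p 0\<close> and \<open>p 1\<close> divide \<open>{..<m}\<close>.\<close>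
  let ?c = "\<lambda>i. if i < 3 then i else if i < 6 then p 0 + (i - 3) else p 1 + (i - 6)"
  have "emb ?c (ttour 9) ?H"
    using p by (auto simp: emb_def inj_on_def)
  then have "emb (\<lambda>u. if u < 9 then ?c u else m + (u - 9)) ?S ?H"
    by (rule hub_emb[where e = "\<lambda>k. m + k"])
       (use p in \<open>auto simp: cut_def hub_def inj_on_def less_2_cases_iff\<close>)
  then have "embeds ?S ?H"
    by (subst embeds_emb_iff) auto
  then have "embeds ?S ?K"
    using fixed_embeds_iff[OF fixed_small, of ?S ?H] by simp
  then obtain f where f: "emb f ?S ?K"
    by (subst (asm) embeds_emb_iff) auto
  obtain c where c: "emb c (ttour m) ?K"
    using F_hub_chain[OF m] by blast
  have cardK: "card (pverts ?K) = m + 2"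
    using F_card[OF H] by simp
  define V where "V = pverts ?K - c ` {..<m}"
  have V: "card V = 2" "finite V"
    using nat_digraph_split[OF K c cardK] by (simp_all add: V_def)
  have inj: "f i = f j \<longleftrightarrow> i = j" if "i < 11" "j < 11" for i j
    using inj_onD[OF embD(1)[OF f], of i j] that by auto
  have fK: "f i \<in> pverts ?K" if "i < 11" for i
    using embD(2)[OF f] that by simp
  have arcs: "(f i, f j) \<in> parcs ?K \<longleftrightarrow> (i, j) \<in> parcs ?S" if "i < 11" "j < 11" for i j
    using embD(3)[OF f] that by simp
  \<comment> \<open>For \<open>i < 3\<close>, the vertices \<open>f u\<close>, \<open>f i\<close>,
    \<open>f (i + 6)\<close> form triangles that share only \<open>f u\<close>, and each must leave
    the copy of the tournament. If \<open>f u\<close> did not, three distinct other vertices would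
    have to, but \<open>V\<close> has only two.\<close>
  have mem: "f u \<in> V" if u: "u = 9 \<or> u = 10" for u
  proof (rule ccontr)
    assume nu: "f u \<notin> V"
    have "f i \<in> V \<or> f (i + 6) \<in> V" if "i < 3" for i
    proof (rule ccontr)
      assume "\<not> ?thesis"
      then have "f u \<in> c ` {..<m}" "f i \<in> c ` {..<m}" "f (i + 6) \<in> c ` {..<m}"
        using nu fK[of u] fK[of i] fK[of "i + 6"] u that by (auto simp: V_def)
      moreover have "(f u, f i) \<in> parcs ?K" "(f i, f (i + 6)) \<in> parcs ?K" "(f (i + 6), f u) \<in> parcs ?K"
        using u that by (auto simp: arcs hub_def[of 9])
      ultimately show False
        by (rule emb_ttour_acyclic[OF c])
    qed
    moreover define t where "t i = (if f i \<in> V then i else i + 6)" for i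
    ultimately have t: "f (t i) \<in> V \<and> (t i = i \<or> t i = i + 6)" if "i < 3" for i
      using that by auto
    have "inj_on (\<lambda>i. f (t i)) {..<3}"
    proof (rule inj_onI)
      fix i j assume "i \<in> {..<3::nat}" "j \<in> {..<3}" "f (t i) = f (t j)"
      then show "i = j"
        using t[of i] t[of j] inj[of "t i" "t j"] by auto
    qed
    moreover have "(\<lambda>i. f (t i)) ` {..<3} \<subseteq> V"
      using t by auto
    ultimately have "card {..<3::nat} \<le> card V"
      using card_inj_on_le V(2) by blast
    then show False using V(1) by simp
  qed
  have Veq: "V = {f 9, f 10}"
    using mem V inj[of 9 10] by (intro card_subset_eq[symmetric]) auto
  have "f 3 \<notin> V"
    unfolding Veq using inj[of 3 9] inj[of 3 10] by simp
  then obtain d where d: "d < m" "f 3 = c d"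
    using fK[of 3] by (auto simp: V_def)
  obtain k where k: "k < 2" "cut ?K c m (f 9) (p k)"
    using hub_extract1[OF sp m c, of "f 9"] mem[of 9] unfolding V_def by blast
  obtain l where l: "l < 2" "cut ?K c m (f 10) (p l)"
    using hub_extract1[OF sp m c, of "f 10"] mem[of 10] unfolding V_def by blast
  \<comment> \<open>Vertex 3 of the test hub lies between its two cuts, so its image
    \<open>c d\<close> separates the values of \<open>f 9\<close> and \<open>f 10\<close> and fixes
    their order.\<close>
  have "(f 3, f 9) \<in> parcs ?K" "(f 10, f 3) \<in> parcs ?K"
    by (simp_all add: arcs hub_def[of 9])
  then have "p k \<le> d" "d < p l"
    using k l d unfolding cut_def by auto
  then have kl: "k = 0" "l = 1"
    using p k(1) l(1) by (auto simp: less_2_cases_iff)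
  have "emb (\<lambda>u. if u < m then c u else f (9 + (u - m))) ?H ?K"
  proof (rule hub_emb[where e = "\<lambda>k. f (9 + k)", OF c])
    show "inj_on (\<lambda>k. f (9 + k)) {..<2}"
      by (rule inj_onI) (simp add: inj)
    show "f (9 + i) \<in> pverts ?K" if "i < 2" for i
      using fK that by simp
    show "cut ?K c m (f (9 + i)) (p i)" if "i < 2" for i
      using k l kl that by (auto simp: less_2_cases_iff)
    show "(f (9 + i), f (9 + j)) \<in> parcs ?K \<longleftrightarrow> R i j" if "i < 2" "j < 2" for i j
      using that arcs[of "9 + i" "9 + j"] by simp
  qed
  then have "embeds ?H ?K"
    by (subst embeds_emb_iff) auto
  then show ?thesis using H by (rule fixedI1[rotated])
qed

text \<open>Single vertices off the tournament yield an index \<open>\<kappa> x\<close>, determined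
  by the cut; pairs show that indices differ and that arcs follow \<open>R\<close>. So
  \<open>\<kappa>\<close> is a bijection by counting, and its inverse lists the further vertices of
  the image.\<close>

lemma fixed_hub:
  assumes sp: "spread m n p" and m: "0 < m"
  shows "fixed (hub m n p R)"
proof -
  let ?H = "hub m n p R"
  let ?K = "F ?H"
  have H: "?H \<in> nat_digraphs" and K: "?K \<in> nat_digraphs" using m by simp_all
  obtain c where c: "emb c (ttour m) ?K"
    using F_hub_chain[OF m] by blast
  have cardK: "card (pverts ?K) = m + n"
    using F_card[OF H] by simp
  define V where "V = pverts ?K - c ` {..<m}"
  have V: "card V = n" "finite V"
    using nat_digraph_split[OF K c cardK] by (simp_all add: V_def)
  have "\<exists>k<n. cut ?K c m x (p k) \<and> ((x, x) \<in> parcs ?K \<longleftrightarrow> R k k)" if "x \<in> V" for x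
    using hub_extract1[OF sp m c] that unfolding V_def by metis
  then obtain \<kappa> where \<kappa>: "\<And>x. x \<in> V \<Longrightarrow> \<kappa> x < n" "\<And>x. x \<in> V \<Longrightarrow> cut ?K c m x (p (\<kappa> x))"
    "\<And>x. x \<in> V \<Longrightarrow> (x, x) \<in> parcs ?K \<longleftrightarrow> R (\<kappa> x) (\<kappa> x)"
    by metis
  have uniq: "k = \<kappa> x" if "x \<in> V" "k < n" "cut ?K c m x (p k)" for x k
    using cut_unique[OF that(3) \<kappa>(2)[OF that(1)]] spreadD(1)[OF sp, of k]
      spreadD(1)[OF sp, of "\<kappa> x"] spreadD(3)[OF sp, of k "\<kappa> x"] \<kappa>(1) that by simp
  have pair: "\<kappa> x \<noteq> \<kappa> y \<and> ((x, y) \<in> parcs ?K \<longleftrightarrow> R (\<kappa> x) (\<kappa> y))"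
    if xy: "x \<in> V" "y \<in> V" "x \<noteq> y" for x y
  proof -
    have "fixed (ind ?H ({..<m} \<union> J'))" if J': "J' \<subseteq> {m..<m + n}" "card J' = card {x, y}" for J'
    proof -
      have "card J' = 2" using J'(2) xy(3) by simp
      then obtain v' w' where vw': "J' = {v', w'}" "v' \<noteq> w'"
        unfolding card_2_iff by blast
      \<comment> \<open>Sorting the two vertices makes their values increasing, as
        \<open>spread\<close> demands.\<close>
      define v w where "v = min v' w'" and "w = max v' w'"
      have vw: "J' = {v, w}" "v < w"
        using vw' by (auto simp: v_def w_def min_def max_def)
      define k l where "k = v - m" and "l = w - m"
      have kl: "v = m + k" "w = m + l" "k < l" "l < n"
        using J'(1) vw by (auto simp: k_def l_def)
      let ?s = "\<lambda>i::nat. if i = 0 then k else l"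
      have "spread m 2 (\<lambda>i. p (?s i))"
        using spreadD(1)[OF sp, of k] spreadD(1)[OF sp, of l] spreadD(2)[OF sp, of l k] kl(3,4)
        by (auto simp: spread_def less_2_cases_iff)
      then have "fixed (hub m 2 (\<lambda>i. p (?s i)) (\<lambda>i j. R (?s i) (?s j)))"
        by (rule fixed_hub_2)
      moreover have "inj_on ?s {..<2}" "?s ` {..<2} \<subseteq> {..<n}"
        using kl(3,4) by (auto simp: inj_on_def less_2_cases_iff)
      ultimately have "fixed (ind ?H ({..<m} \<union> (\<lambda>i. m + ?s i) ` {..<2}))"
        using m by (intro fixed_sub_hub)
      moreover have "(\<lambda>i. m + ?s i) ` {..<2} = J'"
        using vw kl by (auto simp: less_2_cases_iff image_iff)
      ultimately show ?thesis by simp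
    qed
    then obtain g where g: "emb g (ind ?K (c ` {..<m} \<union> {x, y})) ?H" "\<And>i. i < m \<Longrightarrow> g (c i) = i"
      using hub_extract[OF spreadD(1)[OF sp] m c, of "{x, y}"] xy unfolding V_def by blast
    obtain k where k: "k < n" "g x = m + k" "cut ?K c m x (p k)"
      using extracted_vertex[OF g, of x] xy unfolding V_def by blast
    obtain l where l: "l < n" "g y = m + l" "cut ?K c m y (p l)"
      using extracted_vertex[OF g, of y] xy unfolding V_def by blast
    have "k \<noteq> l"
      using inj_onD[OF embD(1)[OF g(1)], of x y] k(2) l(2) xy(3) by auto
    moreover have "(x, y) \<in> parcs ?K \<longleftrightarrow> R k l"
      using embD(3)[OF g(1), of x y] k l by simp
    moreover have "k = \<kappa> x" "l = \<kappa> y"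
      using uniq k l xy by blast+
    ultimately show ?thesis by simp
  qed
  have inj: "inj_on \<kappa> V"
    using pair by (meson inj_onI)
  have im: "\<kappa> ` V = {..<n}"
    using \<kappa>(1) V card_image[OF inj] by (intro card_subset_eq) auto
  define e where "e = inv_into V \<kappa>"
  have e: "e k \<in> V" "\<kappa> (e k) = k" if "k < n" for k
    using that im by (auto simp: e_def inv_into_into f_inv_into_f)
  have "emb (\<lambda>u. if u < m then c u else e (u - m)) ?H ?K"
  proof (rule hub_emb[OF c])
    show "inj_on e {..<n}"
      by (metis e(2) inj_onI lessThan_iff)
    show "e k \<in> pverts ?K" if "k < n" for k
      using e(1)[OF that] by (simp add: V_def)
    show "cut ?K c m (e k) (p k)" if "k < n" for k
      using \<kappa>(2)[OF e(1)[OF that]] e(2)[OF that] by simp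
    show "(e k, e l) \<in> parcs ?K \<longleftrightarrow> R k l" if "k < n" "l < n" for k l
    proof (cases "k = l")
      case True
      then show ?thesis
        using \<kappa>(3)[OF e(1)[OF that(1)]] e(2)[OF that(1)] by simp
    next
      case False
      then have "e k \<noteq> e l"
        using e(2) that by metis
      then show ?thesis
        using pair[OF e(1)[OF that(1)] e(1)[OF that(2)]] e(2)[OF that(1)] e(2)[OF that(2)] by simp
    qed
  qed
  then have "embeds ?H ?K"
    using H K by (subst embeds_emb_iff) auto
  then show ?thesis using H by (rule fixedI1[rotated])
qed

end

section \<open>From hubs to arbitrary digraphs\<close>

lemma nat_digraph_relabel:
  assumes G: "G \<in> nat_digraphs"
  shows "\<exists>R. embeds (mk {..<card (pverts G)} R) G \<and> embeds G (mk {..<card (pverts G)} R)"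
proof -
  let ?n = "card (pverts G)"
  obtain h where h: "bij_betw h {..<?n} (pverts G)"
    using ex_bij_betw_nat_finite[OF nat_digraphs_finite[OF G]] by (auto simp: atLeast0LessThan)
  let ?K = "mk {..<?n} (\<lambda>u v. (h u, h v) \<in> parcs G)"
  have K: "?K \<in> nat_digraphs"
    using nat_digraphs_card_pos[OF G] by auto
  have "emb h ?K G"
    using h by (auto simp: emb_def bij_betw_def)
  then have "embeds ?K G"
    using K G embeds_emb_iff by blast
  then show ?thesis
    using embeds_card_eq_imp_embeds[OF _ K G] by auto
qed

context small_fixing_aut
begin

text \<open>In the hub over a digraph in which every vertex has such a mate, no embedded copy of the
  digraph meets the transitive tournament, as pairs with a vertex in the tournament are
  asymmetric.\<close>

lemma fixed_mates:
  assumes n: "0 < n" and mates: "\<And>i. i < n \<Longrightarrow> \<exists>j<n. j \<noteq> i \<and> (R i j \<longleftrightarrow> R j i)"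
  shows "fixed (mk {..<n} R)"
proof -
  let ?G = "mk {..<n} R"
  \<comment> \<open>The values start above \<open>n\<close> with gaps of 3, and more than
    \<open>n\<close> tournament vertices remain beyond the last of them.\<close>
  define m where "m = 5 * n + 5"
  define p where "p k = n + 1 + 3 * k" for k :: nat
  let ?H = "hub m n p R"
  let ?T = "ttour m"
  have m: "0 < m" by (simp add: m_def)
  have sp: "spread m n p"
    by (auto simp: spread_def m_def p_def)
  have H: "?H \<in> nat_digraphs" and G: "?G \<in> nat_digraphs" and T: "?T \<in> nat_digraphs"
    using m n by auto
  have FG: "F ?G \<in> nat_digraphs" using G by simp
  have fixH: "fixed ?H" by (rule fixed_hub[OF sp m])
  have "emb (\<lambda>i. m + i) ?G ?H"
    by (auto simp: emb_def inj_on_def)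
  then have "embeds ?G ?H"
    using G H embeds_emb_iff by blast
  then have "embeds (F ?G) (F ?H)"
    using F_embeds[OF G H] by simp
  then have "embeds (F ?G) ?H"
    using fixH FG H by (meson F_nd embeds_nat_trans fixed_def)
  then obtain f where f: "emb f (F ?G) ?H"
    using FG H embeds_emb_iff by blast
  have cardFG: "card (pverts (F ?G)) = n"
    using F_card[OF G] by simp
  have hub_id: "d i = i" if "emb d ?T ?H" "i < m" for d i
    using emb_ttour_hub_id[OF that(1) spreadD(1)[OF sp] that(2)] .
  \<comment> \<open>Otherwise the tournament and the copy of \<open>F ?G\<close> together span fewer
    than \<open>m + n\<close> vertices. The preimage \<open>Y\<close> of this span contains both
    \<open>?G\<close> and the tournament; inside the hub these are disjoint, so \<open>Y\<close>
    would have at least \<open>m + n\<close> vertices.\<close>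
  have disj: "f u \<notin> {..<m}" if "u \<in> pverts (F ?G)" for u
  proof
    assume fu: "f u \<in> {..<m}"
    let ?A = "{..<m} \<union> f ` pverts (F ?G)"
    let ?X = "ind ?H ?A"
    have fin: "finite (pverts (F ?G))"
      by (rule nat_digraphs_finite[OF FG])
    have Asub: "?A \<subseteq> pverts ?H"
      using f by (auto simp: emb_def)
    have X: "?X \<in> nat_digraphs"
      using fin m by auto
    have "card ?A < m + n"
    proof -
      have "?A = {..<m} \<union> f ` (pverts (F ?G) - {u})"
        using fu by auto
      then have "card ?A \<le> m + card (f ` (pverts (F ?G) - {u}))"
        using card_Un_le[of "{..<m}" "f ` (pverts (F ?G) - {u})"] by simp
      also have "\<dots> \<le> m + card (pverts (F ?G) - {u})"
        using fin by (simp add: card_image_le)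
      also have "\<dots> < m + n"
        using that fin cardFG n by (simp add: card_Diff_singleton)
      finally show ?thesis .
    qed
    then have cardX: "card (pverts ?X) < m + n" by simp
    have XH: "embeds ?X ?H"
      using Asub H m by (intro embeds_ind) auto
    have XFH: "embeds ?X (F ?H)"
      using XH fixH X H by (meson F_nd embeds_nat_trans fixed_def)
    obtain Y where Y: "Y \<in> nat_digraphs" "embeds Y ?H" "embeds (F Y) ?X" "embeds ?X (F Y)"
      "card (pverts Y) = card (pverts ?X)"
      using embeds_F_preimage[OF X H XFH] by blast
    have FY: "F Y \<in> nat_digraphs" using Y by simp
    have "embeds (F ?G) ?X"
      using emb_into_ind[OF f, of ?A] FG X embeds_emb_iff by blast
    then have "embeds (F ?G) (F Y)"
      using embeds_nat_trans[OF _ Y(4) FG X FY] by simp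
    then have "embeds ?G Y"
      using F_embeds[OF G Y(1)] by simp
    then obtain h where h: "emb h ?G Y"
      using G Y(1) embeds_emb_iff by blast
    have "emb (\<lambda>i. i) ?T ?X"
      by (rule emb_into_ind[OF emb_ttour_hub]) auto
    then have "embeds ?T ?X"
      using T X embeds_emb_iff by blast
    then have "embeds ?T (F Y)"
      using embeds_nat_trans[OF _ Y(4) T X FY] by simp
    then have "embeds ?T Y"
      using fixed_embeds_iff[OF fixed_ttour[OF m] Y(1)] by simp
    then obtain d where d: "emb d ?T Y"
      using T Y(1) embeds_emb_iff by blast
    obtain g where g: "emb g Y ?H"
      using Y(1,2) H embeds_emb_iff by blast
    have gh: "emb (\<lambda>i. g (h i)) ?G ?H"
      by (rule emb_comp[OF h g])
    have ghlt: "g (h i) < m + n" if "i < n" for i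
      using embD(2)[OF gh, of i] that by simp
    have ghge: "m \<le> g (h i)" if i: "i < n" for i
    proof (rule ccontr)
      assume lt: "\<not> m \<le> g (h i)"
      obtain j where j: "j < n" "j \<noteq> i" "R i j \<longleftrightarrow> R j i"
        using mates[OF i] by blast
      have "g (h i) \<noteq> g (h j)"
        using inj_onD[OF embD(1)[OF gh], of i j] i j by auto
      moreover have "(g (h i), g (h j)) \<in> parcs ?H \<longleftrightarrow> (g (h j), g (h i)) \<in> parcs ?H"
        using embD(3)[OF gh, of i j] embD(3)[OF gh, of j i] i j by simp
      ultimately show False
        using lt ghlt[OF j(1)] by (auto simp: hub_def split: if_splits)
    qed
    have im: "(\<lambda>i. g (h i)) ` {..<n} = {m..<m + n}"
    proof (rule card_subset_eq)
      show "(\<lambda>i. g (h i)) ` {..<n} \<subseteq> {m..<m + n}"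
        using ghge ghlt by auto
      show "card ((\<lambda>i. g (h i)) ` {..<n}) = card {m..<m + n}"
        using embD(1)[OF gh] by (simp add: card_image)
    qed simp
    have "{m..<m + n} \<subseteq> g ` pverts Y"
      unfolding im[symmetric] using embD(2)[OF h] by auto
    moreover have "{..<m} \<subseteq> g ` pverts Y"
    proof
      fix i assume "i \<in> {..<m}"
      then have "i = g (d i)" "d i \<in> pverts Y"
        using hub_id[OF emb_comp[OF d g], of i] embD(2)[OF d, of i] by simp_all
      then show "i \<in> g ` pverts Y"
        by (rule image_eqI)
    qed
    moreover have "{..<m + n} \<subseteq> {..<m} \<union> {m..<m + n}"
      by auto
    ultimately have "{..<m + n} \<subseteq> g ` pverts Y"
      by blast
    then have "card {..<m + n} \<le> card (pverts Y)"
      using surj_card_le nat_digraphs_finite[OF Y(1)] by blast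
    then show False
      using cardX Y(5) by simp
  qed
  have "emb (\<lambda>u. f u - m) (F ?G) ?G"
    unfolding emb_def
  proof (intro conjI ballI)
    have lt: "f u < m + n" and ge: "m \<le> f u" if "u \<in> pverts (F ?G)" for u
      using embD(2)[OF f that] disj[OF that] by simp_all
    show "inj_on (\<lambda>u. f u - m) (pverts (F ?G))"
      using embD(1)[OF f] ge by (auto simp: inj_on_def) (metis le_add_diff_inverse)
    show "(\<lambda>u. f u - m) ` pverts (F ?G) \<subseteq> pverts ?G"
      using lt ge by (force simp: image_subset_iff less_diff_conv2)
    fix u v assume uv: "u \<in> pverts (F ?G)" "v \<in> pverts (F ?G)"
    have "f u = m + (f u - m)" "f v = m + (f v - m)" "f u - m < n" "f v - m < n"
      using lt[OF uv(1)] lt[OF uv(2)] ge[OF uv(1)] ge[OF uv(2)] by simp_all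
    then show "(u, v) \<in> parcs (F ?G) \<longleftrightarrow> (f u - m, f v - m) \<in> parcs ?G"
      using embD(3)[OF f uv] parcs_hub2[of "f u - m" n "f v - m" m p R] by simp
  qed
  then have "embeds (F ?G) ?G"
    using FG G embeds_emb_iff by blast
  then show ?thesis
    by (rule fixedI2[OF G])
qed

text \<open>Adding one vertex, joined to all others by no arcs or by arcs in both directions, provides
  the mates. A copy of the image in both extensions cannot use the new vertex in both.\<close>

lemma fixed_mk:
  assumes n: "2 \<le> n"
  shows "fixed (mk {..<n} R)"
proof -
  let ?G = "mk {..<n} R"
  define X where "X b = mk {..<Suc n} (\<lambda>u v. if u < n \<and> v < n then R u v else b)" for b
  have G: "?G \<in> nat_digraphs"
    using n by (simp add: lessThan_empty_iff)
  then have FG: "F ?G \<in> nat_digraphs"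
    by simp
  have X: "X b \<in> nat_digraphs" for b
    by (auto simp: X_def)
  have "embeds (F ?G) (X b)" for b
  proof -
    have "fixed (X b)"
      unfolding X_def
    proof (rule fixed_mates)
      fix i assume "i < Suc n"
      then show "\<exists>j<Suc n. j \<noteq> i \<and> ((if i < n \<and> j < n then R i j else b) \<longleftrightarrow>
          (if j < n \<and> i < n then R j i else b))"
        using n by (intro exI[of _ "if i = n then 0 else n"]) auto
    qed simp
    moreover have "embeds ?G (X b)"
      using G X by (subst embeds_emb_iff) (auto simp: X_def emb_def intro!: exI[of _ "\<lambda>i. i"])
    then have "embeds (F ?G) (F (X b))"
      using F_embeds[OF G X] by simp
    ultimately show ?thesis
      using FG X by (meson F_nd embeds_nat_trans fixed_def)
  qed
  then have "\<exists>f. emb f (F ?G) (X b)" for b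
    using embeds_emb_iff[OF FG X] by blast
  then obtain f where f: "\<And>b. emb (f b) (F ?G) (X b)"
    by metis
  have "\<exists>b. n \<notin> f b ` pverts (F ?G)"
  proof (rule ccontr)
    assume "\<not> ?thesis"
    then have "\<forall>b. \<exists>u. u \<in> pverts (F ?G) \<and> f b u = n"
      by fastforce
    then obtain w where w: "\<And>b. w b \<in> pverts (F ?G)" "\<And>b. f b (w b) = n"
      by metis
    \<comment> \<open>\<open>w b\<close> plays the new vertex of \<open>X b\<close>. If
      \<open>w True\<close> and \<open>w False\<close> agree, a second vertex gets contradictory
      arcs; if they differ, the arcs between the two do.\<close>
    have *: "((w b, v) \<in> parcs (F ?G) \<longleftrightarrow> b) \<and> ((v, w b) \<in> parcs (F ?G) \<longleftrightarrow> b)"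
      if v: "v \<in> pverts (F ?G)" "v \<noteq> w b" for b v
    proof -
      have "f b v < Suc n"
        using embD(2)[OF f[of b] v(1)] by (simp add: X_def)
      then show ?thesis
        using embD(3)[OF f[of b] w(1)[of b] v(1)] embD(3)[OF f[of b] v(1) w(1)[of b]] w(2)[of b]
        by (simp add: X_def)
    qed
    show False
    proof (cases "w True = w False")
      case True
      have "card (pverts (F ?G)) = n"
        using F_card[OF G] by simp
      then have "pverts (F ?G) \<noteq> {w True}"
        using n by auto
      then obtain v where "v \<in> pverts (F ?G)" "v \<noteq> w True"
        using w(1) by blast
      then show False
        using *[of v True] *[of v False] True by simp
    next
      case False
      then show False
        using *[of "w True" False] *[of "w False" True] w(1) by auto
    qed
  qed
  then obtain b where b: "n \<notin> f b ` pverts (F ?G)" by blast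
  have lt: "f b u < n" if "u \<in> pverts (F ?G)" for u
  proof -
    have "f b u \<noteq> n" using b that by blast
    then show ?thesis
      using embD(2)[OF f[of b] that] by (simp add: X_def)
  qed
  have "emb (f b) (F ?G) ?G"
    using f[of b] lt by (auto simp: emb_def X_def)
  then have "embeds (F ?G) ?G"
    using FG G embeds_emb_iff by blast
  then show ?thesis
    by (rule fixedI2[OF G])
qed

lemma fixed_all:
  assumes G: "G \<in> nat_digraphs"
  shows "fixed G"
proof (cases "card (pverts G) \<le> 11")
  case True
  then show ?thesis using G by (rule fixed_small[rotated])
next
  case False
  obtain R where "embeds (mk {..<card (pverts G)} R) G"
    using nat_digraph_relabel[OF G] by blast
  then show ?thesis
    using fixed_cong[OF fixed_mk G, of "card (pverts G)" R] False by simp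
qed

end

section \<open>Preservation of the number of vertices\<close>

text \<open>Deleting a vertex gives a strictly smaller digraph, whose image is strictly below that
  of \<open>G\<close> and so has fewer vertices. Induction starts at one vertex, as no digraph here
  is empty.\<close>

lemma embeds_preserving_card_le:
  assumes nd: "\<And>G. G \<in> nat_digraphs \<Longrightarrow> F G \<in> nat_digraphs"
    and iff: "\<And>G H. G \<in> nat_digraphs \<Longrightarrow> H \<in> nat_digraphs \<Longrightarrow> embeds (F G) (F H) \<longleftrightarrow> embeds G H"
    and "G \<in> nat_digraphs"
  shows "card (pverts G) \<le> card (pverts (F G))"
  using \<open>G \<in> nat_digraphs\<close>
proof (induction "card (pverts G)" arbitrary: G rule: less_induct)
  case less
  note G = \<open>G \<in> nat_digraphs\<close>
  show ?case
  proof (cases "card (pverts G) \<le> 1")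
    case True
    then show ?thesis
      using nat_digraphs_card_pos[OF nd[OF G]] by simp
  next
    case False
    obtain v where v: "v \<in> pverts G"
      using nat_digraphs_card_pos[OF G] by fastforce
    let ?K = "ind G (pverts G - {v})"
    have cardK: "card (pverts ?K) = card (pverts G) - 1"
      using v by simp
    then have "pverts ?K \<noteq> {}"
      using False by (metis card.empty diff_is_0_eq)
    then have K: "?K \<in> nat_digraphs"
      using nat_digraphs_finite[OF G] by simp
    have "embeds ?K G"
      using K G by (intro embeds_ind) auto
    moreover have "\<not> embeds G ?K"
      using embeds_card_le[OF _ G K] cardK False by auto
    ultimately have "embeds (F ?K) (F G)" "\<not> embeds (F G) (F ?K)"
      using iff G K by simp_all
    then have "card (pverts (F ?K)) < card (pverts (F G))"
      using embeds_card_eq_imp_embeds nd G K not_less by blast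
    moreover have "card (pverts ?K) \<le> card (pverts (F ?K))"
      using less(1)[OF _ K] cardK False by simp
    ultimately show ?thesis
      using cardK by simp
  qed
qed

text \<open>The reverse inequality comes from a right inverse \<open>F'\<close> of \<open>F\<close>
  up to isomorphism, which also preserves and reflects embeddings.\<close>

lemma embeds_preserving_card_eq:
  assumes nd: "\<And>G. G \<in> nat_digraphs \<Longrightarrow> F G \<in> nat_digraphs"
    and iff: "\<And>G H. G \<in> nat_digraphs \<Longrightarrow> H \<in> nat_digraphs \<Longrightarrow> embeds (F G) (F H) \<longleftrightarrow> embeds G H"
    and surj: "\<And>H. H \<in> nat_digraphs \<Longrightarrow> \<exists>G\<in>nat_digraphs. embeds (F G) H \<and> embeds H (F G)"
    and G: "G \<in> nat_digraphs"
  shows "card (pverts (F G)) = card (pverts G)"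
proof (rule antisym)
  obtain F' where F': "\<And>H. H \<in> nat_digraphs \<Longrightarrow>
      F' H \<in> nat_digraphs \<and> embeds (F (F' H)) H \<and> embeds H (F (F' H))"
    using surj by metis
  have "embeds (F' H) (F' K) \<longleftrightarrow> embeds H K" if HK: "H \<in> nat_digraphs" "K \<in> nat_digraphs" for H K
  proof -
    have "embeds (F' H) (F' K) \<longleftrightarrow> embeds (F (F' H)) (F (F' K))"
      using iff F' HK by simp
    also have "\<dots> \<longleftrightarrow> embeds H K"
    proof
      assume "embeds (F (F' H)) (F (F' K))"
      then have "embeds H (F (F' K))"
        using embeds_nat_trans[of H "F (F' H)" "F (F' K)"] F' HK nd by simp
      then show "embeds H K"
        using embeds_nat_trans[of H "F (F' K)" K] F' HK nd by simp
    next
      assume "embeds H K"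
      then have "embeds (F (F' H)) K"
        using embeds_nat_trans[of "F (F' H)" H K] F' HK nd by simp
      then show "embeds (F (F' H)) (F (F' K))"
        using embeds_nat_trans[of "F (F' H)" K "F (F' K)"] F' HK nd by simp
    qed
    finally show ?thesis .
  qed
  then have "card (pverts (F G)) \<le> card (pverts (F' (F G)))"
    using embeds_preserving_card_le[of F' "F G"] F' nd[OF G] by blast
  also have "embeds (F' (F G)) G"
    using iff[of "F' (F G)" G] F'[OF nd[OF G]] G by simp
  then have "card (pverts (F' (F G))) \<le> card (pverts G)"
    using embeds_card_le F'[OF nd[OF G]] G by blast
  finally show "card (pverts (F G)) \<le> card (pverts G)" .
  show "card (pverts G) \<le> card (pverts (F G))"
    using embeds_preserving_card_le[of F G] nd iff G by blast
qed

section \<open>Isomorphism types and finiteness of the group\<close>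

abbreviation dtype :: "nat pair_pre_digraph \<Rightarrow> nat pair_pre_digraph set"
  where "dtype G \<equiv> digraph_iso_rel `` {G}"

lemma digraph_types_eq: "digraph_types = dtype ` nat_digraphs"
  by (auto simp: digraph_types_def quotient_def)

lemma dtype_eq_iff:
  assumes "G \<in> nat_digraphs" "H \<in> nat_digraphs"
  shows "dtype G = dtype H \<longleftrightarrow> embeds G H \<and> embeds H G"
proof
  assume "dtype G = dtype H"
  then have "le digraph_poset (dtype G) (dtype H)" "le digraph_poset (dtype H) (dtype G)"
    using digraph_poset_le_class_iff[of G G] embeds_refl assms by auto
  then show "embeds G H \<and> embeds H G"
    using digraph_poset_le_class_iff assms by blast
next
  assume "embeds G H \<and> embeds H G"
  then show "dtype G = dtype H"
    using embeds_antisym assms equiv_class_eq[OF equiv_digraph_iso_rel] by blast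
qed

definition small_types :: "nat pair_pre_digraph set set"
  where "small_types = dtype ` {G \<in> nat_digraphs. card (pverts G) \<le> 11}"

lemma finite_small_types: "finite small_types"
proof -
  \<comment> \<open>Representatives are relabelled onto an initial segment of
    \<open>{..<11}\<close>, which leaves finitely many vertex and arc sets.\<close>
  define Q where "Q = (\<lambda>(V, E). \<lparr>pverts = V, parcs = E\<rparr>) `
    (Pow {..<11::nat} \<times> Pow ({..<11::nat} \<times> {..<11}))"
  have "small_types \<subseteq> dtype ` Q"
  proof
    fix X assume "X \<in> small_types"
    then obtain G where G: "G \<in> nat_digraphs" "card (pverts G) \<le> 11" "X = dtype G"
      by (auto simp: small_types_def)
    obtain R where R: "dtype (mk {..<card (pverts G)} R) = dtype G"
      using nat_digraph_relabel[OF G(1)] dtype_eq_iff G(1) nat_digraphs_card_pos[OF G(1)]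
      by (metis finite_lessThan lessThan_empty_iff mk_nat_digraphs not_less_zero)
    have "mk {..<card (pverts G)} R \<in> Q"
      unfolding Q_def mk_def using G(2) by (intro image_eqI[of _ _ "(_, _)"]) auto
    then show "X \<in> dtype ` Q"
      using R G(3) by (metis imageI)
  qed
  moreover have "finite Q"
    by (simp add: Q_def)
  ultimately show ?thesis
    using finite_subset by blast
qed

text \<open>Membership in \<open>order_auto\<close> without extensionality, so that composites with
  \<open>inv_into\<close> qualify as they stand.\<close>

definition order_bij :: "(nat pair_pre_digraph set \<Rightarrow> nat pair_pre_digraph set) \<Rightarrow> bool"
  where "order_bij f \<longleftrightarrow> bij_betw f digraph_types digraph_types \<and>
    (\<forall>X\<in>digraph_types. \<forall>Y\<in>digraph_types. le digraph_poset (f X) (f Y) \<longleftrightarrow> le digraph_poset X Y)"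

text \<open>\<open>F\<close> picks a representative of each image type, which gives the data of the
  locale \<open>small_fixing_aut\<close>.\<close>

lemma order_bij_on_digraphs:
  assumes "order_bij f"
  obtains F where "\<And>G. G \<in> nat_digraphs \<Longrightarrow> F G \<in> nat_digraphs"
    "\<And>G. G \<in> nat_digraphs \<Longrightarrow> dtype (F G) = f (dtype G)"
    "\<And>G H. G \<in> nat_digraphs \<Longrightarrow> H \<in> nat_digraphs \<Longrightarrow> embeds (F G) (F H) \<longleftrightarrow> embeds G H"
    "\<And>H. H \<in> nat_digraphs \<Longrightarrow> \<exists>G\<in>nat_digraphs. embeds (F G) H \<and> embeds H (F G)"
proof -
  have f: "f ` digraph_types = digraph_types"
    "\<And>X Y. X \<in> digraph_types \<Longrightarrow> Y \<in> digraph_types \<Longrightarrow>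
      le digraph_poset (f X) (f Y) \<longleftrightarrow> le digraph_poset X Y"
    using assms by (auto simp: order_bij_def bij_betw_def)
  have "\<exists>H\<in>nat_digraphs. dtype H = f (dtype G)" if "G \<in> nat_digraphs" for G
  proof -
    have "f (dtype G) \<in> digraph_types"
      using f(1) that digraph_types_eq by blast
    then show ?thesis
      unfolding digraph_types_eq by auto
  qed
  then obtain F where F: "\<And>G. G \<in> nat_digraphs \<Longrightarrow> F G \<in> nat_digraphs"
    "\<And>G. G \<in> nat_digraphs \<Longrightarrow> dtype (F G) = f (dtype G)"
    by metis
  have "embeds (F G) (F H) \<longleftrightarrow> embeds G H" if "G \<in> nat_digraphs" "H \<in> nat_digraphs" for G H
    using digraph_poset_le_class_iff[OF that] digraph_poset_le_class_iff[OF F(1) F(1), OF that]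
      f(2)[of "dtype G" "dtype H"] F(2) that by (simp add: digraph_types_eq)
  moreover have "\<exists>G\<in>nat_digraphs. embeds (F G) H \<and> embeds H (F G)" if H: "H \<in> nat_digraphs" for H
  proof -
    have "dtype H \<in> f ` digraph_types"
      using f(1) H digraph_types_eq by blast
    then obtain G where G: "G \<in> nat_digraphs" "dtype H = f (dtype G)"
      unfolding digraph_types_eq by auto
    then have "dtype (F G) = dtype H"
      using F(2) by simp
    then show ?thesis
      using dtype_eq_iff[OF F(1) H] G(1) by blast
  qed
  ultimately show ?thesis
    using that F by blast
qed

lemma order_bij_small_types:
  assumes "order_bij f" "X \<in> small_types"
  shows "f X \<in> small_types"
proof -
  obtain F where F: "\<And>G. G \<in> nat_digraphs \<Longrightarrow> F G \<in> nat_digraphs"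
    "\<And>G. G \<in> nat_digraphs \<Longrightarrow> dtype (F G) = f (dtype G)"
    "\<And>G H. G \<in> nat_digraphs \<Longrightarrow> H \<in> nat_digraphs \<Longrightarrow> embeds (F G) (F H) \<longleftrightarrow> embeds G H"
    "\<And>H. H \<in> nat_digraphs \<Longrightarrow> \<exists>G\<in>nat_digraphs. embeds (F G) H \<and> embeds H (F G)"
    using order_bij_on_digraphs[OF assms(1)] by metis
  obtain G where G: "G \<in> nat_digraphs" "card (pverts G) \<le> 11" "X = dtype G"
    using assms(2) by (auto simp: small_types_def)
  have "card (pverts (F G)) \<le> 11"
    using embeds_preserving_card_eq[OF F(1,3,4) G(1)] G(2) by simp
  then show ?thesis
    unfolding small_types_def using F(1)[OF G(1)] F(2)[OF G(1)] G(3)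
    by (intro image_eqI[of _ _ "F G"]) auto
qed

lemma order_bij_eq_id:
  assumes "order_bij f" and fix_small: "\<And>X. X \<in> small_types \<Longrightarrow> f X = X" and "X \<in> digraph_types"
  shows "f X = X"
proof -
  obtain F where F: "\<And>G. G \<in> nat_digraphs \<Longrightarrow> F G \<in> nat_digraphs"
    "\<And>G. G \<in> nat_digraphs \<Longrightarrow> dtype (F G) = f (dtype G)"
    "\<And>G H. G \<in> nat_digraphs \<Longrightarrow> H \<in> nat_digraphs \<Longrightarrow> embeds (F G) (F H) \<longleftrightarrow> embeds G H"
    "\<And>H. H \<in> nat_digraphs \<Longrightarrow> \<exists>G\<in>nat_digraphs. embeds (F G) H \<and> embeds H (F G)"
    using order_bij_on_digraphs[OF assms(1)] by metis
  interpret small_fixing_aut F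
  proof
    show "card (pverts (F G)) = card (pverts G)" if "G \<in> nat_digraphs" for G
      by (rule embeds_preserving_card_eq[OF F(1,3,4) that])
    show "embeds G (F G)" if G: "G \<in> nat_digraphs" "card (pverts G) \<le> 11" for G
    proof -
      have "dtype G \<in> small_types"
        using G by (auto simp: small_types_def)
      then have "dtype (F G) = dtype G"
        using fix_small F(2)[OF G(1)] by simp
      then show ?thesis
        using dtype_eq_iff[OF F(1) G(1)] G(1) by blast
    qed
  qed (use F in blast)+
  obtain G where G: "G \<in> nat_digraphs" "X = dtype G"
    using assms(3) digraph_types_eq by auto
  have "dtype (F G) = dtype G"
    using fixed_all[OF G(1)] dtype_eq_iff[OF F(1) G(1)] G(1) by (auto simp: fixed_def)
  then show ?thesis
    using F(2)[OF G(1)] G(2) by simp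
qed

lemma order_bij_inv_comp:
  assumes f: "order_bij f" and g: "order_bij g"
  shows "order_bij (inv_into digraph_types f \<circ> g)"
proof -
  let ?D = digraph_types
  have bij: "bij_betw f ?D ?D" "bij_betw g ?D ?D"
    using f g by (simp_all add: order_bij_def)
  have "bij_betw (inv_into ?D f \<circ> g) ?D ?D"
    using bij_betw_trans[OF bij(2) bij_betw_inv_into[OF bij(1)]] .
  moreover have "le digraph_poset (inv_into ?D f (g X)) (inv_into ?D f (g Y)) \<longleftrightarrow>
      le digraph_poset X Y" if XY: "X \<in> ?D" "Y \<in> ?D" for X Y
  proof -
    have gD: "g X \<in> ?D" "g Y \<in> ?D"
      using bij(2) XY by (auto simp: bij_betw_def)
    then have "inv_into ?D f (g X) \<in> ?D" "inv_into ?D f (g Y) \<in> ?D"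
      using bij_betw_inv_into[OF bij(1)] by (auto simp: bij_betw_def)
    then have "le digraph_poset (inv_into ?D f (g X)) (inv_into ?D f (g Y)) \<longleftrightarrow>
        le digraph_poset (f (inv_into ?D f (g X))) (f (inv_into ?D f (g Y)))"
      using f by (simp add: order_bij_def)
    also have "\<dots> \<longleftrightarrow> le digraph_poset (g X) (g Y)"
      using bij_betw_inv_into_right[OF bij(1)] gD by simp
    also have "\<dots> \<longleftrightarrow> le digraph_poset X Y"
      using g XY by (simp add: order_bij_def)
    finally show ?thesis .
  qed
  ultimately show ?thesis
    by (simp add: order_bij_def)
qed

text \<open>The inverse of \<open>f\<close> composed with \<open>g\<close> fixes all small types,
  hence is the identity on types.\<close>

lemma order_bij_eqI:
  assumes f: "order_bij f" and g: "order_bij g"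
    and eq: "\<And>X. X \<in> small_types \<Longrightarrow> f X = g X" and X: "X \<in> digraph_types"
  shows "f X = g X"
proof -
  let ?D = digraph_types
  have bij: "bij_betw f ?D ?D" "bij_betw g ?D ?D"
    using f g by (simp_all add: order_bij_def)
  have "inv_into ?D f (g Y) = Y" if Y: "Y \<in> small_types" for Y
  proof -
    have "Y \<in> ?D"
      using Y by (auto simp: small_types_def digraph_types_eq)
    then show ?thesis
      using eq[OF Y] bij_betw_inv_into_left[OF bij(1)] by metis
  qed
  then have "inv_into ?D f (g X) = X"
    using order_bij_eq_id[OF order_bij_inv_comp[OF f g] _ X] by simp
  moreover have "g X \<in> ?D"
    using bij(2) X by (auto simp: bij_betw_def)
  ultimately show ?thesis
    using bij_betw_inv_into_right[OF bij(1)] by metis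
qed

theorem theorem2:
  shows "finite (carrier (order_AutoGroup digraph_poset))"
proof -
  let ?A = "order_auto digraph_poset"
  have A: "order_bij f" "f \<in> extensional digraph_types" if "f \<in> ?A" for f
    using that by (auto simp: order_auto_digraph_poset_iff order_bij_def)
  let ?r = "\<lambda>f. restrict f small_types"
  have "inj_on ?r ?A"
  proof (rule inj_onI)
    fix f g assume fg: "f \<in> ?A" "g \<in> ?A" "?r f = ?r g"
    have "f X = g X" if "X \<in> small_types" for X
      using fun_cong[OF fg(3), of X] that by simp
    then show "f = g"
      using order_bij_eqI[OF A(1)[OF fg(1)] A(1)[OF fg(2)]] A(2) fg(1,2)
      by (intro extensionalityI[of f digraph_types g]) auto
  qed
  \<comment> \<open>Sizes are preserved, so restrictions are among the finitely many self-maps of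
    \<open>small_types\<close>.\<close>
  moreover have "?r ` ?A \<subseteq> small_types \<rightarrow>\<^sub>E small_types"
    using A(1) order_bij_small_types by auto
  then have "finite (?r ` ?A)"
    by (rule finite_subset) (intro finite_PiE finite_small_types)
  ultimately have "finite ?A"
    using finite_image_iff by blast
  then show ?thesis
    by (simp add: order_AutoGroup_def)
qed

end
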